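(* Let $(G_n)_{n\ge 0}$ be the sequence of graphs defined in the context, and let $T_n(x,y)=T(G_n;x,y)$ be the Tutte polynomial of $G_n$. For every $n\ge 0$: (i) the number of acyclic root-connected orientations of $G_n$ is given by $$T_n(1,0)=\prod_{i=0}^{n}(i+1)^{2\cdot 4^{\,n-i}};$$ (ii) the number of indegree sequences of strongly connected orientations of $G_n$ is given by $$T_n(0,1)=\frac{n}{2}\prod_{i=0}^{n}(i+1)^{2\cdot 4^{\,n-i}}.$$
   Context: Tutte polynomial: for a graph $G$ with vertex set $V(G)$, edge set $E(G)$ and $k(G)$ connected components, put $r(G)=|V(G)|-k(G)$ and $n(G)=|E(G)|-|V(G)|+k(G)$. Then $T(G;x,y)=\sum_{H\subseteq G}(x-1)^{r(G)-r(H)}(y-1)^{n(H)}$, where the sum runs over all spanning subgraphs $H$ of $G$ (subgraphs with $V(H)=V(G)$ and arbitrary $E(H)\subseteq E(G)$). The graphs $G_n$: $G_0$ is the complete graph $K_2$ with its two vertices denoted $X_0,Y_0$. For $n\ge 0$, given $G_n$ with two special vertices $X_n,Y_n$, take four disjoint copies $G_n^1,G_n^2,G_n^3,G_n^4$ of $G_n$, with special vertices $X_n^i,Y_n^i$. Identify $X_n^1$ with $X_n^2$ to form the special vertex $X_{n+1}$ of $G_{n+1}$; identify $Y_n^3$ with $Y_n^4$ to form the special vertex $Y_{n+1}$ of $G_{n+1}$; identify $Y_n^1$ with $X_n^3$ to form a vertex $a$, and $Y_n^2$ with $X_n^4$ to form a vertex $b$; finally add a new edge $e_n$ joining $a$ and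 $b$. The result is $G_{n+1}$. Orientations: an orientation of a graph is the digraph obtained by choosing a direction for every edge. It is acyclic if it has no directed cycle. It is root-connected, with respect to an arbitrarily fixed root vertex, if every vertex can be reached from the root by a directed path. It is strongly connected if every vertex can be reached from every other vertex by a directed path. The indegree sequence of an orientation is the function assigning to each (labelled) vertex the number of edges directed into it; item (ii) counts distinct indegree sequences that arise from strongly connected orientations. Facts recalled in the paper for a connected graph $G$: $T(G;1,0)$ is the number of acyclic root-connected orientations of $G$ (for any fixed root), and $T(G;0,1)$ is the number of indegree sequences of strongly connected orientations of $G$. *)

theory Defs
  imports Complex_Main
begin

section \<open>Graphs and the Tutte polynomial\<close>

text \<open>
  Simple graphs: an edge is the two-element set of its ends.  All graphs considered below are
  simple (lemma \<open>Gn_simple\<close>).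
\<close>

record 'a ugraph =
  verts :: "'a set"
  edges :: "'a set set"

definition connected_rel :: "'a ugraph \<Rightarrow> ('a \<times> 'a) set" where
  "connected_rel G = {(u, v) \<in> verts G \<times> verts G. (u, v) \<in> {(a, b). {a, b} \<in> edges G}\<^sup>*}"

definition num_components :: "'a ugraph \<Rightarrow> nat" where
  "num_components G = card (verts G // connected_rel G)"

text \<open>
  For finite simple graphs none of the natural-number subtractions below is truncated:
  \<open>k(G) \<le> |V(G)| \<le> |E(G)| + k(G)\<close>, and the rank of a spanning subgraph is at most that of the graph.
\<close>

definition rank :: "'a ugraph \<Rightarrow> nat" where
  "rank G = card (verts G) - num_components G"

definition nullity :: "'a ugraph \<Rightarrow> nat" where
  "nullity G = card (edges G) + num_components G - card (verts G)"

definition tutte :: "'a ugraph \<Rightarrow> 'b :: comm_ring_1 \<Rightarrow> 'b \<Rightarrow> 'b" where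
  "tutte G x y =
     (\<Sum>F\<in>Pow (edges G).
        (x - 1) ^ (rank G - rank (G\<lparr>edges := F\<rparr>)) * (y - 1) ^ nullity (G\<lparr>edges := F\<rparr>))"


section \<open>Orientations\<close>

text \<open>
  An orientation is given by its set of arcs (tail, head); each edge underlies exactly one arc.
\<close>

definition orientation :: "'a ugraph \<Rightarrow> ('a \<times> 'a) set \<Rightarrow> bool" where
  "orientation G D \<longleftrightarrow> bij_betw (\<lambda>(u, v). {u, v}) D (edges G)"

definition root_connected :: "'a ugraph \<Rightarrow> 'a \<Rightarrow> ('a \<times> 'a) set \<Rightarrow> bool" where
  "root_connected G r D \<longleftrightarrow> (\<forall>v\<in>verts G. (r, v) \<in> D\<^sup>*)"

definition strongly_connected :: "'a ugraph \<Rightarrow> ('a \<times> 'a) set \<Rightarrow> bool" where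
  "strongly_connected G D \<longleftrightarrow> (\<forall>u\<in>verts G. \<forall>v\<in>verts G. (u, v) \<in> D\<^sup>*)"

text \<open>
  As a function on the whole vertex type; it vanishes outside the vertex set of the graph, so
  distinct functions correspond to distinct indegree sequences.
\<close>

definition indegrees :: "('a \<times> 'a) set \<Rightarrow> 'a \<Rightarrow> nat" where
  "indegrees D v = card {u. (u, v) \<in> D}"


section \<open>The graphs \<open>G\<^sub>n\<close>\<close>

text \<open>
  At every level \<open>vX\<close> and \<open>vY\<close> are the special vertices \<open>X\<^sub>n\<close> and \<open>Y\<^sub>n\<close>.  The vertices \<open>vA\<close> and
  \<open>vB\<close> are the vertices \<open>a\<close> and \<open>b\<close> created in the last step, and \<open>Inner i v\<close> is the non-special
  vertex \<open>v\<close> of the \<open>i\<close>-th copy of the previous graph.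
\<close>

datatype copy = C1 | C2 | C3 | C4

datatype vertex = vX | vY | vA | vB | Inner copy vertex

text \<open>
  \<open>glue i v\<close> is the vertex of the next graph to which the vertex \<open>v\<close> of the \<open>i\<close>-th copy is sent;
  lemma \<open>glue_eq_iff\<close> shows that exactly the prescribed vertices are identified.
\<close>

fun glue :: "copy \<Rightarrow> vertex \<Rightarrow> vertex" where
  "glue C1 vX = vX"
| "glue C2 vX = vX"
| "glue C3 vX = vA"
| "glue C4 vX = vB"
| "glue C1 vY = vA"
| "glue C2 vY = vB"
| "glue C3 vY = vY"
| "glue C4 vY = vY"
| "glue i v = Inner i v"

fun Gn :: "nat \<Rightarrow> vertex ugraph" where
  "Gn 0 = \<lparr>verts = {vX, vY}, edges = {{vX, vY}}\<rparr>"
| "Gn (Suc n) =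
     \<lparr>verts = (\<Union>i. glue i ` verts (Gn n)),
      edges = insert {vA, vB} (\<Union>i. (\<lambda>e. glue i ` e) ` edges (Gn n))\<rparr>"

lemma glue_eq_iff:
  "glue i v = glue j w \<longleftrightarrow>
     (i, v) = (j, w) \<or>
     {(i, v), (j, w)} \<in> {{(C1, vX), (C2, vX)}, {(C3, vY), (C4, vY)},
                         {(C1, vY), (C3, vX)}, {(C2, vY), (C4, vX)}}"
  by (cases i; cases j; cases v; cases w) (auto simp: doubleton_eq_iff)

lemma inj_glue: "inj (glue i)"
  by (rule injI) (auto simp: glue_eq_iff doubleton_eq_iff)

lemma UNIV_copy: "UNIV = {C1, C2, C3, C4}"
  by (auto intro: copy.exhaust)

lemma special_in_Gn: "vX \<in> verts (Gn n)" "vY \<in> verts (Gn n)"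
proof (induction n)
  case (Suc n)
  { case 1 show ?case using Suc by (auto intro!: exI[of _ C1] image_eqI[of _ _ vX]) }
  { case 2 show ?case using Suc by (auto intro!: exI[of _ C3] image_eqI[of _ _ vY]) }
qed auto

lemma finite_Gn: "finite (verts (Gn n))" "finite (edges (Gn n))"
  by (induction n) (auto simp: UNIV_copy)

lemma Gn_simple: "e \<in> edges (Gn n) \<Longrightarrow> e \<subseteq> verts (Gn n) \<and> card e = 2"
proof (induction n arbitrary: e)
  case (Suc n)
  have "vA \<in> glue C1 ` verts (Gn n)" "vB \<in> glue C2 ` verts (Gn n)"
    using special_in_Gn(2)[of n] by (force intro: image_eqI[of _ _ vY])+
  then have "{vA, vB} \<subseteq> verts (Gn (Suc n))" by auto
  moreover have "card (glue i ` e') = card e'" for i e'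
    by (meson card_image inj_glue inj_on_subset subset_UNIV)
  ultimately show ?case using Suc by fastforce
qed auto

text \<open>No parallel edges arise, so nothing is lost by working with sets of edges.\<close>

lemma card_two_glue_inter:
  assumes "card e = 2" "card f = 2" "glue i ` e = glue j ` f"
  shows "i = j"
proof (rule ccontr)
  assume "i \<noteq> j"
  obtain p q where e: "e = {p, q}" "p \<noteq> q" using assms(1) by (auto simp: card_2_iff)
  obtain r s where f: "f = {r, s}" "r \<noteq> s" using assms(2) by (auto simp: card_2_iff)
  show False
    using assms(3) \<open>i \<noteq> j\<close> e f
    by (cases i; cases j; auto simp: doubleton_eq_iff glue_eq_iff)
qed

lemma new_edge_not_glued:
  assumes "card e = 2"
  shows "glue i ` e \<noteq> {vA, vB}"
proof -
  obtain p q where e: "e = {p, q}" "p \<noteq> q" using assms by (auto simp: card_2_iff)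
  show ?thesis
    unfolding e(1) by (cases i; cases p; cases q; simp add: doubleton_eq_iff)
qed

lemma card_edges_Gn_Suc: "card (edges (Gn (Suc n))) = 4 * card (edges (Gn n)) + 1"
proof -
  let ?I = "\<lambda>i. (\<lambda>e. glue i ` e) ` edges (Gn n)"
  have "card (?I i) = card (edges (Gn n))" for i
    by (intro card_image inj_onI) (meson inj_glue inj_image_eq_iff)
  moreover have "?I i \<inter> ?I j = {}" if "i \<noteq> j" for i j
    using that Gn_simple card_two_glue_inter by (auto; metis)
  ultimately have "card (\<Union>i. ?I i) = (\<Sum>i\<in>(UNIV::copy set). card (edges (Gn n)))"
    by (subst card_UN_disjoint) (auto simp: finite_Gn UNIV_copy)
  then have "card (\<Union>i. ?I i) = 4 * card (edges (Gn n))"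
    by (simp add: UNIV_copy)
  moreover have "{vA, vB} \<notin> (\<Union>i. ?I i)"
    using Gn_simple new_edge_not_glued by (auto; metis)
  ultimately show ?thesis
    by (simp add: finite_Gn UNIV_copy)
qed

end

theory Submission
  imports Defs
begin

text \<open>
  Both counts are related to the Tutte polynomial by deletion--contraction of edges at a root.  A
  contraction only enlarges the set of roots, so every graph that occurs remains simple.
  For \<open>T(1, 0)\<close> one counts acyclic orientations in which the set \<open>R\<close> of roots has no incoming arc
  and reaches everything.  For \<open>T(0, 1)\<close> one counts the integer vectors \<open>d\<close> for which \<open>d(W)\<close> lies
  strictly between the number of edges inside \<open>W\<close> and the number of edges touching \<open>W\<close>, for all
  nonempty \<open>W\<close> avoiding the roots; by an uncrossing argument these are the indegree sequences of
  strongly connected orientations.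

  On the other side, \<open>G\<^sub>n\<^sub>+\<^sub>1\<close> arises from \<open>K\<^sub>4\<close> minus the edge \<open>XY\<close> by replacing the four edges other
  than \<open>ab\<close> by copies of \<open>G\<^sub>n\<close>, so the signed sums over connected subgraphs and over forests, split
  according to whether \<open>X\<close> and \<open>Y\<close> are joined, satisfy a polynomial recursion.  In both cases the
  ratio of the two parts decreases by \<open>1/2\<close> in each step, which gives the closed forms.
\<close>

section \<open>Connectivity and numbers of components\<close>

text \<open>Write C and S for the parts of a \<open>tsum\<close> with X and Y joined and separated.
  At \<open>(x, y) = (0, 1)\<close>, which belongs to T(1, 0), the recursion gives S'/C' = S/C -
  1/2; at \<open>(1, 0)\<close>, which belongs to T(0, 1), it gives C'/S' = C/S - 1/2. The single
  edge \<open>Gn 0\<close> starts both ratios at -1, so they equal -(n+2)/2. The factor (n+2)^2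
  gained by the product in each step is four times the squared ratio, and n/2 is (n+2)/2 - 1: T(0,
  1) adds both parts, since a forest may or may not join X and Y.

  The two counting theorems have different side conditions because a loop contributes a factor y to
  the Tutte polynomial and a bridge a factor x. At (1, 0) an edge inside the root set makes both
  sides vanish, and bridges need no case of their own. At (0, 1) edges inside the root set are
  harmless but a bridge makes both sides vanish; recognising bridges of the contracted graph
  requires a record of how the roots were merged, which is the tree \<open>T\<close> carried by the
  second induction.\<close>

definition joined :: "'a set set \<Rightarrow> 'a \<Rightarrow> 'a \<Rightarrow> bool" where
  "joined F a b \<longleftrightarrow> (a, b) \<in> {(a, b). {a, b} \<in> F}\<^sup>*"

definition ncomp :: "'a set \<Rightarrow> 'a set set \<Rightarrow> nat" where
  "ncomp V F = card (V // {(u, v) \<in> V \<times> V. joined F u v})"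

definition graph_on :: "'a set \<Rightarrow> 'a set set \<Rightarrow> bool" where
  "graph_on V E \<longleftrightarrow> finite V \<and> (\<forall>e\<in>E. e \<subseteq> V \<and> card e = 2)"

lemma num_components_eq: "num_components G = ncomp (verts G) (edges G)"
  by (simp add: num_components_def ncomp_def connected_rel_def joined_def)

lemma graph_on_finite: "graph_on V E \<Longrightarrow> finite V" "graph_on V E \<Longrightarrow> finite E"
proof -
  assume *: "graph_on V E"
  then show "finite V" by (simp add: graph_on_def)
  then have "finite (Pow V)" by simp
  moreover have "E \<subseteq> Pow V" using * by (auto simp: graph_on_def)
  ultimately show "finite E" by (rule rev_finite_subset)
qed

lemma graph_on_subset: "graph_on V E \<Longrightarrow> F \<subseteq> E \<Longrightarrow> graph_on V F"
  by (auto simp: graph_on_def)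

lemma graph_on_Un: "graph_on V E \<Longrightarrow> graph_on V F \<Longrightarrow> graph_on V (E \<union> F)"
  by (auto simp: graph_on_def)

lemma graph_on_insert: "graph_on V (insert {a, b} E) \<longleftrightarrow> graph_on V E \<and> a \<in> V \<and> b \<in> V \<and> a \<noteq> b"
  by (auto simp: graph_on_def card_2_iff doubleton_eq_iff)

lemma graph_on_edgeE:
  assumes "graph_on V E" "e \<in> E"
  obtains a b where "e = {a, b}" "a \<noteq> b" "a \<in> V" "b \<in> V"
proof -
  have "card e = 2" "e \<subseteq> V" using assms by (auto simp: graph_on_def)
  then obtain a b where "e = {a, b}" "a \<noteq> b" by (auto simp: card_2_iff)
  then show ?thesis using that \<open>e \<subseteq> V\<close> by auto
qed

lemma graph_on_induct [consumes 1, case_names empty insert]: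
  assumes "graph_on V E"
    and "P {}"
    and "\<And>a b F. \<lbrakk>a \<in> V; b \<in> V; a \<noteq> b; {a, b} \<notin> F; graph_on V F; P F\<rbrakk> \<Longrightarrow> P (insert {a, b} F)"
  shows "P E"
proof -
  have "finite E" using assms(1) by (rule graph_on_finite)
  then show ?thesis using assms(1)
  proof (induction E rule: finite_induct)
    case empty
    then show ?case using assms(2) by simp
  next
    case (insert e F)
    obtain a b where e: "e = {a, b}" "a \<noteq> b" "a \<in> V" "b \<in> V"
      using graph_on_edgeE[OF insert.prems] by blast
    have "graph_on V F" using insert.prems by (auto intro: graph_on_subset)
    then show ?case using insert assms(3)[of a b F] e by simp
  qed
qed

lemma joined_refl [simp]: "joined F a a"
  by (simp add: joined_def)

lemma joined_sym: "joined F a b \<Longrightarrow> joined F b a"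
proof -
  have "sym {(a, b). {a, b} \<in> F}" by (auto simp: sym_def insert_commute)
  then have "sym ({(a, b). {a, b} \<in> F}\<^sup>*)" by (rule sym_rtrancl)
  then show "joined F a b \<Longrightarrow> joined F b a" by (auto simp: joined_def sym_def)
qed

lemma joined_trans: "joined F a b \<Longrightarrow> joined F b c \<Longrightarrow> joined F a c"
  by (auto simp: joined_def)

lemma joined_edge: "{a, b} \<in> F \<Longrightarrow> joined F a b"
  by (auto simp: joined_def)

lemma joined_mono: "joined F a b \<Longrightarrow> F \<subseteq> F' \<Longrightarrow> joined F' a b"
  unfolding joined_def by (rule rtrancl_mono[THEN subsetD, rotated]) auto

lemma joined_induct [consumes 1, case_names refl step]:
  assumes "joined F a b" "P a" "\<And>x y. joined F a x \<Longrightarrow> {x, y} \<in> F \<Longrightarrow> P x \<Longrightarrow> P y"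
  shows "P b"
  using assms(1) unfolding joined_def
  by (induction rule: rtrancl_induct) (use assms(2,3) in \<open>auto simp: joined_def\<close>)

lemma joined_empty [simp]: "joined {} a b \<longleftrightarrow> a = b"
  by (auto simp: joined_def)

lemma joined_insert:
  "joined (insert {a, b} F) x y \<longleftrightarrow>
     joined F x y \<or> joined F x a \<and> joined F b y \<or> joined F x b \<and> joined F a y"
proof
  assume "joined (insert {a, b} F) x y"
  then show "joined F x y \<or> joined F x a \<and> joined F b y \<or> joined F x b \<and> joined F a y"
  proof (induction rule: joined_induct)
    case (step p q)
    show ?case
    proof (cases "{p, q} \<in> F")
      case True
      then have "joined F p q" by (rule joined_edge)
      then show ?thesis using step.IH joined_trans by metis
    next
      case False
      then have "p = a \<and> q = b \<or> p = b \<and> q = a" using step.hyps by (auto simp: doubleton_eq_iff)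
      then show ?thesis using step.IH by (metis joined_refl)
    qed
  qed simp
next
  have m: "joined F u v \<Longrightarrow> joined (insert {a, b} F) u v" for u v by (rule joined_mono) auto
  have "joined (insert {a, b} F) a b" by (rule joined_edge) simp
  moreover assume "joined F x y \<or> joined F x a \<and> joined F b y \<or> joined F x b \<and> joined F a y"
  ultimately show "joined (insert {a, b} F) x y" using m joined_trans joined_sym by metis
qed

lemma joined_insert_cancel: "joined F a b \<Longrightarrow> joined (insert {a, b} F) = joined F"
  by (intro ext) (metis joined_insert joined_sym joined_trans)

lemma joined_outside:
  assumes "graph_on V F" "joined F a b" "a \<notin> V \<or> b \<notin> V"
  shows "a = b"
proof -
  have "joined F a b \<Longrightarrow> a = b \<or> a \<in> V \<and> b \<in> V" for a b
    by (induction rule: joined_induct) (use assms(1) in \<open>auto simp: graph_on_def\<close>)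
  then show ?thesis using assms by blast
qed

lemma joined_image:
  assumes "graph_on V F" "inj f"
  shows "joined ((`) f ` F) (f x) (f y) \<longleftrightarrow> joined F x y"
  using assms(1)
proof (induction arbitrary: x y rule: graph_on_induct)
  case empty
  then show ?case using assms(2) by (simp add: inj_eq)
next
  case (insert a b F)
  then show ?case by (simp add: joined_insert)
qed

section \<open>Component classes, and how one edge changes their number\<close>

definition cls :: "'a set \<Rightarrow> 'a set set \<Rightarrow> 'a \<Rightarrow> 'a set" where
  "cls V F x = {y \<in> V. joined F x y}"

lemma ncomp_cls: "ncomp V F = card (cls V F ` V)"
proof -
  have "V // {(u, v) \<in> V \<times> V. joined F u v} = cls V F ` V"
    by (auto simp: quotient_def cls_def Image_def)
  then show ?thesis by (simp add: ncomp_def)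
qed

lemma cls_eq_iff: "x \<in> V \<Longrightarrow> y \<in> V \<Longrightarrow> cls V F x = cls V F y \<longleftrightarrow> joined F x y"
  unfolding cls_def by (auto dest: joined_sym joined_trans)

lemma ncomp_empty: "ncomp V {} = card V"
proof -
  have "cls V {} ` V = (\<lambda>x. {x}) ` V" by (auto simp: cls_def)
  then show ?thesis by (simp add: ncomp_cls card_image)
qed

lemma ncomp_insert:
  assumes "finite V" "a \<in> V" "b \<in> V"
  shows "ncomp V (insert {a, b} F) + of_bool (\<not> joined F a b) = ncomp V F"
proof (cases "joined F a b")
  case True
  then show ?thesis by (simp add: ncomp_def joined_insert_cancel)
next
  case False
  let ?A = "cls V F a" and ?B = "cls V F b"
  have new: "cls V (insert {a, b} F) x = (if joined F x a \<or> joined F x b then ?A \<union> ?B else cls V F x)"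
    if "x \<in> V" for x
    unfolding cls_def by (auto simp: joined_insert dest: joined_sym joined_trans)
  have eq: "cls V (insert {a, b} F) ` V = insert (?A \<union> ?B) (cls V F ` V - {?A, ?B})"
  proof (intro equalityI subsetI)
    fix S assume "S \<in> cls V (insert {a, b} F) ` V"
    then obtain x where x: "x \<in> V" "S = cls V (insert {a, b} F) x" by blast
    then show "S \<in> insert (?A \<union> ?B) (cls V F ` V - {?A, ?B})"
      using new[OF x(1)] cls_eq_iff[of x V] assms by auto
  next
    fix S assume S: "S \<in> insert (?A \<union> ?B) (cls V F ` V - {?A, ?B})"
    then consider "S = ?A \<union> ?B" | x where "x \<in> V" "S = cls V F x" "S \<noteq> ?A" "S \<noteq> ?B" by blast
    then show "S \<in> cls V (insert {a, b} F) ` V"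
    proof cases
      case 1
      then have "S = cls V (insert {a, b} F) a" using new[OF assms(2)] by simp
      then show ?thesis using assms by blast
    next
      case 2
      then have "S = cls V (insert {a, b} F) x" using new[of x] cls_eq_iff[of x V] assms by auto
      then show ?thesis using 2 by blast
    qed
  qed
  have notin: "?A \<union> ?B \<notin> cls V F ` V - {?A, ?B}"
  proof
    assume "?A \<union> ?B \<in> cls V F ` V - {?A, ?B}"
    then obtain x where x: "x \<in> V" "?A \<union> ?B = cls V F x" "cls V F x \<noteq> ?A" by auto
    have "a \<in> ?A" using assms by (simp add: cls_def)
    then have "a \<in> cls V F x" using x(2) by blast
    then have "joined F x a" by (simp add: cls_def)
    then show False using x cls_eq_iff[of x V a] assms by auto
  qed
  have AB: "?A \<noteq> ?B" "{?A, ?B} \<subseteq> cls V F ` V" using False cls_eq_iff[of a V b] assms by auto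
  have fin: "finite (cls V F ` V)" using assms by simp
  have "card (cls V F ` V) \<ge> 2" using card_mono[OF fin AB(2)] AB(1) by simp
  moreover have "card (cls V F ` V - {?A, ?B}) = card (cls V F ` V) - 2"
    using card_Diff_subset[OF _ AB(2)] AB(1) by simp
  ultimately show ?thesis unfolding ncomp_cls eq using notin fin False by simp
qed

lemma ncomp_le_card: "finite V \<Longrightarrow> ncomp V F \<le> card V"
  unfolding ncomp_cls by (rule card_image_le)

text \<open>One edge merges at most two components. The bound keeps the exponent of \<open>y\<close>
  in \<open>tsum\<close> from being truncated; its equality case is the later definition of
  \<open>forest\<close>.\<close>

lemma card_le_ncomp:
  assumes "graph_on V F" shows "card V \<le> card F + ncomp V F"
  using assms
proof (induction rule: graph_on_induct)
  case empty
  then show ?case by (simp add: ncomp_empty)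
next
  case (insert a b F)
  then show ?case using ncomp_insert[of V a b F] graph_on_finite[OF insert.hyps(5)]
    by (simp add: of_bool_def split: if_splits)
qed

text \<open>Keeps the exponent of \<open>x\<close> in \<open>tsum\<close> from being truncated:
  separated terminals already occupy two components. With \<open>s = t\<close> it says that there is
  at least one component.\<close>

lemma two_le_ncomp:
  assumes "finite V" "s \<in> V" "t \<in> V"
  shows "2 \<le> ncomp V F + of_bool (joined F s t)"
proof (cases "joined F s t")
  case True
  have "ncomp V F > 0" using assms unfolding ncomp_cls by (auto simp: card_gt_0_iff)
  then show ?thesis using True by simp
next
  case False
  then have "card {cls V F s, cls V F t} = 2" using cls_eq_iff[of s V t] assms by simp
  moreover have "card {cls V F s, cls V F t} \<le> ncomp V F"
    unfolding ncomp_cls using assms by (intro card_mono) auto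
  ultimately show ?thesis by simp
qed

lemma ncomp_eq_1_iff:
  assumes "finite V" "r \<in> V"
  shows "ncomp V F = 1 \<longleftrightarrow> (\<forall>v\<in>V. joined F r v)"
proof
  assume "ncomp V F = 1"
  then show "\<forall>v\<in>V. joined F r v" using two_le_ncomp[OF assms] by (force simp: of_bool_def split: if_splits)
next
  assume "\<forall>v\<in>V. joined F r v"
  then have "cls V F ` V = {cls V F r}" using cls_eq_iff[of r V] assms by (auto simp: image_iff)
  then show "ncomp V F = 1" by (simp add: ncomp_cls)
qed

lemma ncomp_image:
  assumes "graph_on V F" "inj f"
  shows "ncomp (f ` V) ((`) f ` F) = ncomp V F"
  using assms(1)
proof (induction rule: graph_on_induct)
  case empty
  then show ?case using assms(2) by (simp add: ncomp_empty card_image inj_on_subset)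
next
  case (insert a b F)
  have "ncomp (f ` V) (insert {f a, f b} ((`) f ` F)) + of_bool (\<not> joined ((`) f ` F) (f a) (f b)) = ncomp (f ` V) ((`) f ` F)"
    using insert by (intro ncomp_insert) (auto simp: graph_on_def)
  moreover have "ncomp V (insert {a, b} F) + of_bool (\<not> joined F a b) = ncomp V F"
    using insert by (intro ncomp_insert) (auto simp: graph_on_def)
  ultimately show ?case using insert joined_image[OF insert.hyps(5) assms(2)] by simp
qed

lemma ncomp_isolated:
  assumes "graph_on V F" "finite U"
  shows "ncomp (V \<union> U) F + card V = ncomp V F + card (V \<union> U)"
  using assms(1)
proof (induction rule: graph_on_induct)
  case empty
  then show ?case by (simp add: ncomp_empty)
next
  case (insert a b F)
  have "ncomp (V \<union> U) (insert {a, b} F) + of_bool (\<not> joined F a b) = ncomp (V \<union> U) F"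
    using insert assms by (intro ncomp_insert) (auto simp: graph_on_def)
  moreover have "ncomp V (insert {a, b} F) + of_bool (\<not> joined F a b) = ncomp V F"
    using insert by (intro ncomp_insert) (auto simp: graph_on_def)
  ultimately show ?case using insert by linarith
qed

section \<open>Gluing two graphs at two vertices\<close>

lemma joined_two_sum:
  assumes G: "graph_on V1 F1" "graph_on V2 F2" and "V1 \<inter> V2 = {s, t}" and uv: "u \<in> V2" "v \<in> V2"
  shows "joined (F1 \<union> F2) u v \<longleftrightarrow> joined (if joined F1 s t then insert {s, t} F2 else F2) u v"
proof -
  \<comment> \<open>The first graph acts on \<open>V2\<close> only through whether it joins
    \<open>s\<close> and \<open>t\<close>, that is, as a virtual edge.\<close>
  define F' where "F' = (if joined F1 s t then insert {s, t} F2 else F2)"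
  have 1: "joined F' z w" if "joined F1 z w" "z \<in> V2" "w \<in> V2" for z w
  proof (cases "z = w")
    case False
    then have "z \<in> V1" "w \<in> V1" using joined_outside[OF G(1) that(1)] by auto
    then have "z \<in> {s, t}" "w \<in> {s, t}" using that assms(3) by auto
    then have "{z, w} = {s, t}" using False by auto
    then show ?thesis using that(1) joined_edge[of z w F'] joined_sym[of F1]
      by (auto simp: F'_def doubleton_eq_iff)
  qed simp
  \<comment> \<open>Invariant along a walk: from some vertex \<open>z\<close> of \<open>V2\<close>
    reached within \<open>F'\<close>, the current vertex is reached inside
    \<open>F1\<close>.\<close>
  have "\<exists>z\<in>V2. joined F' u z \<and> joined F1 z v" if "joined (F1 \<union> F2) u v" for v
    using that
  proof (induction rule: joined_induct)
    case refl
    then show ?case using uv joined_refl by metis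
  next
    case (step p q)
    then obtain z where z: "z \<in> V2" "joined F' u z" "joined F1 z p" by blast
    show ?case
    proof (cases "{p, q} \<in> F1")
      case True
      then show ?thesis using z joined_edge joined_trans by metis
    next
      case False
      then have "{p, q} \<in> F2" using step by blast
      then have pq: "p \<in> V2" "q \<in> V2" "{p, q} \<in> F'" using G by (auto simp: graph_on_def F'_def)
      then have "joined F' u q" using 1[OF z(3)] z joined_trans joined_edge by metis
      then show ?thesis using pq joined_refl by metis
    qed
  qed
  then have "joined (F1 \<union> F2) u v \<Longrightarrow> joined F' u v" using 1 uv joined_trans by metis
  moreover have "joined (F1 \<union> F2) u v" if "joined F' u v"
  proof (cases "joined F1 s t")
    case True
    then have "joined (insert {s, t} (F1 \<union> F2)) = joined (F1 \<union> F2)"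
      by (intro joined_insert_cancel) (blast intro: joined_mono)
    moreover have "joined (insert {s, t} (F1 \<union> F2)) u v"
      using that by (rule joined_mono) (auto simp: F'_def)
    ultimately show ?thesis by simp
  next
    case False
    then show ?thesis using that by (auto simp: F'_def intro: joined_mono)
  qed
  ultimately show ?thesis unfolding F'_def by blast
qed

text \<open>Induction on \<open>F1\<close>. If a new edge links \<open>s\<close> to \<open>t\<close>
  in \<open>F1\<close>, the first two terms on the right keep their sum, and the change is that of
  the virtual edge in the second graph: a drop unless \<open>F2\<close> already joins
  \<open>s\<close> and \<open>t\<close>. The 2 accounts for the two shared vertices.\<close>

lemma ncomp_two_sum:
  assumes "graph_on V1 F1" "graph_on V2 F2" "V1 \<inter> V2 = {s, t}" "s \<noteq> t"
  shows "ncomp (V1 \<union> V2) (F1 \<union> F2) + 2 = ncomp V1 F1 + of_bool (joined F1 s t)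
           + ncomp V2 (if joined F1 s t then insert {s, t} F2 else F2)"
  using assms(1)
proof (induction rule: graph_on_induct)
  case empty
  have fin: "finite V1" "finite V2" using assms by (auto dest: graph_on_finite)
  have "card (V2 \<union> V1) + 2 = card V2 + card V1"
    using card_Un_Int[of V2 V1] fin assms(3,4) by (simp add: Int_commute)
  then show ?case using ncomp_isolated[OF assms(2), of V1] fin assms(4)
    by (simp add: ncomp_empty Un_commute)
next
  case (insert u v F1)
  have fin: "finite V1" "finite V2" using assms by (auto dest: graph_on_finite)
  have st: "s \<in> V1" "t \<in> V1" "s \<in> V2" "t \<in> V2" using assms(3) by auto
  \<comment> \<open>The roles are exchanged: replacing \<open>F2\<close> by a virtual edge expresses
    all conditions through \<open>F1\<close>.\<close>
  have "joined (F2 \<union> F1) u v \<longleftrightarrow> joined (if joined F2 s t then insert {s, t} F1 else F1) u v"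
    using insert assms by (intro joined_two_sum[of V2 _ V1]) auto
  then have J: "joined (F1 \<union> F2) u v \<longleftrightarrow> joined F1 u v \<or>
      joined F2 s t \<and> (joined F1 s u \<and> joined F1 v t \<or> joined F1 s v \<and> joined F1 u t)"
    by (auto simp: joined_insert Un_commute dest: joined_sym)
  have c': "joined (insert {u, v} F1) s t \<longleftrightarrow>
      joined F1 s t \<or> joined F1 s u \<and> joined F1 v t \<or> joined F1 s v \<and> joined F1 u t"
    by (simp add: joined_insert)
  \<comment> \<open>\<open>A\<close> and \<open>B\<close> exclude impossible cases: if
    \<open>{u, v}\<close> links \<open>s\<close> to \<open>t\<close>, then \<open>F1\<close> joins
    \<open>u\<close> and \<open>v\<close> iff it joins \<open>s\<close> and
    \<open>t\<close>.\<close>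
  have A: "joined F1 s t"
    if "joined F1 u v" "joined F1 s u \<and> joined F1 v t \<or> joined F1 s v \<and> joined F1 u t"
    using that by (metis joined_sym joined_trans)
  have B: "joined F1 u v"
    if "joined F1 s t" "joined F1 s u \<and> joined F1 v t \<or> joined F1 s v \<and> joined F1 u t"
    using that by (metis joined_sym joined_trans)
  have 1: "ncomp (V1 \<union> V2) (insert {u, v} (F1 \<union> F2)) + of_bool (\<not> joined (F1 \<union> F2) u v) = ncomp (V1 \<union> V2) (F1 \<union> F2)"
    using fin insert by (intro ncomp_insert) auto
  have 2: "ncomp V1 (insert {u, v} F1) + of_bool (\<not> joined F1 u v) = ncomp V1 F1"
    using fin insert by (intro ncomp_insert) auto
  have 3: "ncomp V2 (insert {s, t} F2) + of_bool (\<not> joined F2 s t) = ncomp V2 F2"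
    using fin st by (intro ncomp_insert) auto
  show ?case
    using insert.IH 1 2 3 J c' A B
    by (cases "joined F1 u v"; cases "joined F1 s t"; cases "joined F2 s t";
        cases "joined F1 s u \<and> joined F1 v t \<or> joined F1 s v \<and> joined F1 u t"; simp)
qed

section \<open>Subgraph sums of 2-sums\<close>

lemma sum_Pow_Un:
  assumes "A \<inter> B = {}"
  shows "(\<Sum>F\<in>Pow (A \<union> B). h F) = (\<Sum>F\<in>Pow A. \<Sum>F'\<in>Pow B. h (F \<union> F'))"
proof -
  have "(\<Sum>F\<in>Pow (A \<union> B). h F) = (\<Sum>(F, F')\<in>Pow A \<times> Pow B. h (F \<union> F'))"
    by (rule sum.reindex_bij_witness[of _ "\<lambda>(F, F'). F \<union> F'" "\<lambda>F. (F \<inter> A, F \<inter> B)"])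
      (use assms in \<open>auto simp: Int_Un_distrib[symmetric] Int_absorb2\<close>)
  then show ?thesis by (simp add: sum.cartesian_product)
qed

text \<open>
  The spanning subgraphs \<open>F \<union> K\<close> with \<open>F \<subseteq> E\<close> in which the terminals \<open>s\<close> and \<open>t\<close> are joined
  (if \<open>c\<close>) or not joined (otherwise).  Both exponents are sums over the parts of a 2-sum; at
  \<open>(x, y) = (0, 1)\<close> and \<open>(1, 0)\<close> the condition that an exponent vanishes becomes connectedness
  up to the terminals, or being a forest.
\<close>

definition tsum :: "'a set \<Rightarrow> 'a \<Rightarrow> 'a \<Rightarrow> real \<Rightarrow> real \<Rightarrow> 'a set set \<Rightarrow> 'a set set \<Rightarrow> bool \<Rightarrow> real" where
  "tsum V s t x y E K c =
     (\<Sum>F\<in>Pow E. if joined (F \<union> K) s t = c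
        then (-1) ^ card F * x ^ (ncomp V (F \<union> K) + of_bool c - 2)
               * y ^ (card (F \<union> K) + ncomp V (F \<union> K) - card V)
        else 0)"

text \<open>Both exponents are additive once the first part of a subgraph is replaced by the edge
  \<open>{s, t}\<close> or by nothing. \<open>K\<close> collects such replacement edges: they count
  in the exponents but carry no sign. As \<open>{s, t}\<close> is a new edge of the second graph,
  that graph stays simple.\<close>

lemma tsum_two_sum:
  assumes G: "graph_on V1 E1" "graph_on V2 (E2 \<union> K)" and V: "V1 \<inter> V2 = {s, t}" "s \<noteq> t"
    and K: "{s, t} \<notin> E2 \<union> K" and T: "p \<in> V2" "q \<in> V2"
  shows "tsum (V1 \<union> V2) p q x y (E1 \<union> E2) K c =
           tsum V1 s t x y E1 {} True * tsum V2 p q x y E2 (insert {s, t} K) c +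
           tsum V1 s t x y E1 {} False * tsum V2 p q x y E2 K c"
proof -
  have disj: "E1 \<inter> (E2 \<union> K) = {}"
  proof (rule ccontr)
    assume "E1 \<inter> (E2 \<union> K) \<noteq> {}"
    then obtain e where e: "e \<in> E1" "e \<in> E2 \<union> K" by blast
    have "e \<subseteq> V1" "e \<subseteq> V2" "card e = 2" using G e by (auto simp: graph_on_def)
    then have "e \<subseteq> {s, t}" "card e = 2" using V(1) by auto
    then have "e = {s, t}" using V(2) by (intro card_subset_eq) auto
    then show False using e K by simp
  qed
  have fin: "finite V1" "finite V2" "finite E1" "finite (E2 \<union> K)"
    using G by (auto dest: graph_on_finite)
  have cardV: "card (V1 \<union> V2) + 2 = card V1 + card V2"
    using card_Un_Int[of V1 V2] fin V by simp
  let ?K = "\<lambda>b. if b then insert {s, t} K else K"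
  define h where "h V u v F F' d =
    (if joined (F \<union> F') u v = d
     then (-1) ^ card F * x ^ (ncomp V (F \<union> F') + of_bool d - 2) * y ^ (card (F \<union> F') + ncomp V (F \<union> F') - card V)
     else 0)" for V :: "'a set" and u v F F' d
  have prod: "h (V1 \<union> V2) p q (F1 \<union> F2) K c =
      h V1 s t F1 {} (joined F1 s t) * h V2 p q F2 (?K (joined F1 s t)) c"
    if F: "F1 \<in> Pow E1" "F2 \<in> Pow E2" for F1 F2
  proof -
    let ?b = "joined F1 s t" and ?F = "F1 \<union> F2 \<union> K"
    have g: "graph_on V1 F1" "graph_on V2 (F2 \<union> K)" "graph_on V2 (F2 \<union> ?K ?b)"
      using G F V T by (auto intro: graph_on_subset simp: graph_on_insert)
    have eqK: "(if ?b then insert {s, t} (F2 \<union> K) else F2 \<union> K) = F2 \<union> ?K ?b" by auto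
    have J: "joined ?F p q = joined (F2 \<union> ?K ?b) p q"
      using joined_two_sum[OF g(1,2) V(1) T] eqK by (simp add: Un_assoc)
    have C: "ncomp (V1 \<union> V2) ?F + 2 = ncomp V1 F1 + of_bool ?b + ncomp V2 (F2 \<union> ?K ?b)"
      using ncomp_two_sum[OF g(1,2) V] eqK by (simp add: Un_assoc)
    have fF: "finite F1" "finite (F2 \<union> K)" using g by (auto dest: graph_on_finite)
    have "{s, t} \<notin> F2 \<union> K" using K F by auto
    then have "card (F2 \<union> ?K ?b) = card (F2 \<union> K) + of_bool ?b"
      using fF(2) by simp
    moreover have "card ?F = card F1 + card (F2 \<union> K)"
      using fF disj F by (subst Un_assoc, intro card_Un_disjoint) auto
    ultimately have D: "card ?F + of_bool ?b = card F1 + card (F2 \<union> ?K ?b)" by simp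
    have E: "card (F1 \<union> F2) = card F1 + card F2"
      using fF disj F by (intro card_Un_disjoint) auto
    \<comment> \<open>Lower bounds that make the natural-number subtractions below exact.\<close>
    have I: "2 \<le> ncomp V1 F1 + of_bool ?b"
      "2 \<le> ncomp V2 (F2 \<union> ?K ?b) + of_bool (joined (F2 \<union> ?K ?b) p q)"
      "card V1 \<le> card F1 + ncomp V1 F1" "card V2 \<le> card (F2 \<union> ?K ?b) + ncomp V2 (F2 \<union> ?K ?b)"
    proof -
      show "2 \<le> ncomp V1 F1 + of_bool ?b" using fin V(1) by (intro two_le_ncomp) auto
      show "2 \<le> ncomp V2 (F2 \<union> ?K ?b) + of_bool (joined (F2 \<union> ?K ?b) p q)"
        using fin(2) T by (rule two_le_ncomp)
    qed (fact card_le_ncomp[OF g(1)] card_le_ncomp[OF g(3)])+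
    have x: "ncomp (V1 \<union> V2) ?F + of_bool c - 2 =
      (ncomp V1 F1 + of_bool ?b - 2) + (ncomp V2 (F2 \<union> ?K ?b) + of_bool c - 2)"
      if "joined (F2 \<union> ?K ?b) p q = c"
      using C I(1,2) unfolding that by linarith
    \<comment> \<open>Adding \<open>C\<close> and \<open>D\<close> cancels
      \<open>of_bool ?b\<close>.\<close>
    have y: "card ?F + ncomp (V1 \<union> V2) ?F - card (V1 \<union> V2) =
      (card F1 + ncomp V1 F1 - card V1) + (card (F2 \<union> ?K ?b) + ncomp V2 (F2 \<union> ?K ?b) - card V2)"
      using C D I(3,4) cardV by linarith
    show ?thesis unfolding h_def J E Un_empty_right using x y by (simp add: power_add)
  qed
  have "tsum (V1 \<union> V2) p q x y (E1 \<union> E2) K c =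
      (\<Sum>F1\<in>Pow E1. \<Sum>F2\<in>Pow E2. h (V1 \<union> V2) p q (F1 \<union> F2) K c)"
    unfolding tsum_def h_def using disj by (subst sum_Pow_Un) auto
  also have "\<dots> = (\<Sum>F1\<in>Pow E1. \<Sum>F2\<in>Pow E2. h V1 s t F1 {} (joined F1 s t) * h V2 p q F2 (?K (joined F1 s t)) c)"
    using prod by (intro sum.cong) auto
  also have "\<dots> = (\<Sum>F1\<in>Pow E1. h V1 s t F1 {} (joined F1 s t) * tsum V2 p q x y E2 (?K (joined F1 s t)) c)"
    unfolding tsum_def h_def by (simp add: sum_distrib_left)
  also have "\<dots> = (\<Sum>F1\<in>Pow E1. h V1 s t F1 {} True * tsum V2 p q x y E2 (?K True) c
      + h V1 s t F1 {} False * tsum V2 p q x y E2 (?K False) c)"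
    by (intro sum.cong) (auto simp: h_def)
  finally show ?thesis
    by (simp add: sum.distrib sum_distrib_right[symmetric] tsum_def h_def)
qed

lemma tsum_image:
  assumes "graph_on V E" "inj f"
  shows "tsum (f ` V) (f s) (f t) x y ((`) f ` E) {} c = tsum V s t x y E {} c"
proof -
  have inj: "inj ((`) f)" using assms(2) by (auto simp: inj_on_def inj_image_eq_iff)
  have Pow: "Pow ((`) f ` E) = (`) ((`) f) ` Pow E" by (auto simp: image_Pow_surj)
  have inj': "inj_on ((`) ((`) f)) (Pow E)" using inj by (auto simp: inj_on_def inj_image_eq_iff)
  have eq: "joined ((`) f ` F) (f s) (f t) = joined F s t" "ncomp (f ` V) ((`) f ` F) = ncomp V F"
      "card ((`) f ` F) = card F"
    if "F \<in> Pow E" for F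
    using joined_image[of V F f] ncomp_image[of V F f] graph_on_subset[OF assms(1), of F] that assms(2)
      card_image[of "(`) f" F] inj by (auto intro: inj_on_subset)
  have "card (f ` V) = card V" using assms(2) by (intro card_image) (auto intro: inj_on_subset)
  then show ?thesis
    unfolding tsum_def Pow sum.reindex[OF inj'] Un_empty_right by (intro sum.cong) (simp_all add: eq)
qed

section \<open>The sums of \<open>Gn\<close> and their recursion\<close>

lemma graph_on_Gn: "graph_on (verts (Gn n)) (edges (Gn n))"
  using Gn_simple finite_Gn by (auto simp: graph_on_def)

definition tsum_Gn :: "real \<Rightarrow> real \<Rightarrow> nat \<Rightarrow> bool \<Rightarrow> real" where
  "tsum_Gn x y n c = tsum (verts (Gn n)) vX vY x y (edges (Gn n)) {} c"

lemma graph_on_glue: "graph_on (glue i ` verts (Gn n)) ((`) (glue i) ` edges (Gn n))"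
proof -
  have "card (glue i ` e) = card e" for e
    by (meson card_image inj_glue inj_on_subset subset_UNIV)
  then show ?thesis using Gn_simple finite_Gn by (fastforce simp: graph_on_def)
qed

abbreviation core :: "vertex set" where
  "core \<equiv> {vX, vY, vA, vB}"

lemma glue_in_core_iff: "glue i v \<in> core \<longleftrightarrow> v = vX \<or> v = vY"
  by (cases i; cases v) auto

lemma glue_Int_core: "glue i v = glue j w \<Longrightarrow> i \<noteq> j \<Longrightarrow> glue i v \<in> core"
  by (cases i; cases v; cases j; cases w) auto

lemma ncomp_insert':
  "finite V \<Longrightarrow> a \<in> V \<Longrightarrow> b \<in> V \<Longrightarrow> ncomp V (insert {a, b} F) = ncomp V F - of_bool (\<not> joined F a b)"
  using ncomp_insert[of V a b F] by simp

text \<open>Distinct copies overlap only in the core, so by the two bounds on \<open>V2\<close> copy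
  \<open>i\<close> meets it in exactly its two terminals and can be traded for an edge or for
  nothing.\<close>

lemma tsum_glue:
  assumes G: "graph_on V2 (E2 \<union> K)"
    and V: "core \<subseteq> V2" "V2 \<subseteq> core \<union> (\<Union>j\<in>- {i}. range (glue j))"
    and K: "{glue i vX, glue i vY} \<notin> E2 \<union> K"
  shows "tsum (glue i ` verts (Gn n) \<union> V2) vX vY x y ((`) (glue i) ` edges (Gn n) \<union> E2) K c =
           tsum_Gn x y n True * tsum V2 vX vY x y E2 (insert {glue i vX, glue i vY} K) c +
           tsum_Gn x y n False * tsum V2 vX vY x y E2 K c"
proof -
  have st: "glue i vX \<noteq> glue i vY" by (cases i) auto
  have "glue i ` verts (Gn n) \<inter> V2 = {glue i vX, glue i vY}"
  proof (intro equalityI subsetI)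
    fix z assume z: "z \<in> glue i ` verts (Gn n) \<inter> V2"
    then obtain v where v: "z = glue i v" by blast
    then have "z \<in> core" using z V(2) glue_Int_core[of i v] by fastforce
    then show "z \<in> {glue i vX, glue i vY}" using v glue_in_core_iff by auto
  next
    fix z assume "z \<in> {glue i vX, glue i vY}"
    then show "z \<in> glue i ` verts (Gn n) \<inter> V2"
      using special_in_Gn[of n] V(1) glue_in_core_iff by blast
  qed
  then have "tsum (glue i ` verts (Gn n) \<union> V2) vX vY x y ((`) (glue i) ` edges (Gn n) \<union> E2) K c =
      tsum (glue i ` verts (Gn n)) (glue i vX) (glue i vY) x y ((`) (glue i) ` edges (Gn n)) {} True
        * tsum V2 vX vY x y E2 (insert {glue i vX, glue i vY} K) c +
      tsum (glue i ` verts (Gn n)) (glue i vX) (glue i vY) x y ((`) (glue i) ` edges (Gn n)) {} False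
        * tsum V2 vX vY x y E2 K c"
    using V(1) by (intro tsum_two_sum graph_on_glue G K st) auto
  then show ?thesis by (simp add: tsum_image[OF graph_on_Gn inj_glue] tsum_Gn_def)
qed

lemma Pow_singleton: "Pow {a} = {{}, {a}}"
  by auto

text \<open>The copies are peeled off in the order \<open>C1\<close>, \<open>C2\<close>,
  \<open>C3\<close>, \<open>C4\<close>, each leaving in \<open>K\<close> an edge of the 4-cycle X,
  A, Y, B or nothing. \<open>w3\<close>, \<open>w2\<close>, \<open>w1\<close>, \<open>w\<close> are
  the sums left after one to four peelings, so the unfolded formula runs over the 16 subsets of the
  cycle.\<close>

lemma tsum_Gn_Suc:
  fixes n :: nat and x y :: real and c :: bool
  defines "t \<equiv> tsum_Gn x y n"
  defines "w \<equiv> (\<lambda>K. tsum core vX vY x y {{vA, vB}} K c)"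
  defines "w1 \<equiv> (\<lambda>K. t True * w (insert {vB, vY} K) + t False * w K)"
  defines "w2 \<equiv> (\<lambda>K. t True * w1 (insert {vA, vY} K) + t False * w1 K)"
  defines "w3 \<equiv> (\<lambda>K. t True * w2 (insert {vX, vB} K) + t False * w2 K)"
  shows "tsum_Gn x y (Suc n) c = t True * w3 {{vX, vA}} + t False * w3 {}"
proof -
  define gV where "gV i = glue i ` verts (Gn n)" for i
  define gE where "gE i = (`) (glue i) ` edges (Gn n)" for i
  have "core \<subseteq> verts (Gn (Suc n))"
    using image_eqI[of vX "glue C1" vX "verts (Gn n)"] image_eqI[of vY "glue C3" vY "verts (Gn n)"]
      image_eqI[of vA "glue C1" vY "verts (Gn n)"] image_eqI[of vB "glue C2" vY "verts (Gn n)"]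
      special_in_Gn[of n] by (simp del: image_eqI) blast
  then have VE: "verts (Gn (Suc n)) = gV C1 \<union> (gV C2 \<union> (gV C3 \<union> (gV C4 \<union> core)))"
    "edges (Gn (Suc n)) = gE C1 \<union> (gE C2 \<union> (gE C3 \<union> (gE C4 \<union> {{vA, vB}})))"
    by (auto simp: gV_def gE_def UNIV_copy)
  have core_graph: "graph_on V K"
    if "K \<subseteq> {{vX, vA}, {vX, vB}, {vA, vY}, {vB, vY}, {vA, vB}}" "core \<subseteq> V" "finite V" for V K
    using that by (auto simp: graph_on_def)
  \<comment> \<open>Edges of different copies never coincide, so no copy contains the edge that
    replaces another one.\<close>
  have no: "{glue j vX, glue j vY} \<notin> gE i" if "i \<noteq> j" for i j
  proof
    assume "{glue j vX, glue j vY} \<in> gE i"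
    then obtain e where e: "e \<in> edges (Gn n)" "glue i ` e = glue j ` {vX, vY}" by (auto simp: gE_def)
    then have "i = j" using Gn_simple by (intro card_two_glue_inter[of e "{vX, vY}"]) auto
    then show False using that by simp
  qed
  have gr: "graph_on (gV i \<union> V) (gE i \<union> E)" if "graph_on V E" for i V E
    using graph_on_glue[of i n] that unfolding graph_on_def gV_def gE_def by blast
  have ran: "gV i \<subseteq> (\<Union>j\<in>- {k}. range (glue j))" if "i \<noteq> k" for i k
    using that by (auto simp: gV_def)
  \<comment> \<open>\<open>V2\<close>, \<open>V3\<close>, \<open>V4\<close> are what remains after
    removing the first one, two and three copies.\<close>
  define V4 E4 where "V4 = gV C4 \<union> core" and "E4 = gE C4 \<union> {{vA, vB}}"
  define V3 E3 where "V3 = gV C3 \<union> V4" and "E3 = gE C3 \<union> E4"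
  define V2 E2 where "V2 = gV C2 \<union> V3" and "E2 = gE C2 \<union> E3"
  note defs = V4_def E4_def V3_def E3_def V2_def E2_def
  have sub: "core \<subseteq> V4" "core \<subseteq> V3" "core \<subseteq> V2" by (auto simp: defs)
  have "graph_on core {{vA, vB}}" by (auto simp: graph_on_def)
  then have g4: "graph_on V4 E4" unfolding V4_def E4_def by (rule gr)
  then have g3: "graph_on V3 E3" unfolding V3_def E3_def by (rule gr)
  then have g2: "graph_on V2 E2" unfolding V2_def E2_def by (rule gr)
  have V: "V2 \<subseteq> core \<union> (\<Union>j\<in>- {C1}. range (glue j))" "V3 \<subseteq> core \<union> (\<Union>j\<in>- {C2}. range (glue j))"
    "V4 \<subseteq> core \<union> (\<Union>j\<in>- {C3}. range (glue j))"
    unfolding defs using ran by (intro Un_least; blast)+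
  have E: "{vX, vA} \<notin> E2" "{vX, vB} \<notin> E3" "{vA, vY} \<notin> E4"
    using no[of C2 C1] no[of C3 C1] no[of C4 C1] no[of C3 C2] no[of C4 C2] no[of C4 C3]
    by (simp_all add: defs doubleton_eq_iff)
  have step: "tsum (gV i \<union> V) vX vY x y (gE i \<union> E) K c =
      t True * tsum V vX vY x y E (insert {glue i vX, glue i vY} K) c + t False * tsum V vX vY x y E K c"
    if "graph_on V E" "K \<subseteq> {{vX, vA}, {vX, vB}, {vA, vY}, {vB, vY}, {vA, vB}}" "core \<subseteq> V"
      "V \<subseteq> core \<union> (\<Union>j\<in>- {i}. range (glue j))" "{glue i vX, glue i vY} \<notin> E" "{glue i vX, glue i vY} \<notin> K"
    for i V E K
    unfolding gV_def gE_def t_def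
  proof (rule tsum_glue)
    show "graph_on V (E \<union> K)"
      using that(1) core_graph[OF that(2,3) graph_on_finite(1)[OF that(1)]] by (rule graph_on_Un)
    show "{glue i vX, glue i vY} \<notin> E \<union> K" using that(5,6) by blast
  qed (fact that(3,4))+
  have s1: "tsum (gV C1 \<union> V2) vX vY x y (gE C1 \<union> E2) {} c =
      t True * tsum V2 vX vY x y E2 {{vX, vA}} c + t False * tsum V2 vX vY x y E2 {} c"
    using step[of V2 E2 "{}" C1] g2 sub V E by simp
  have s2: "tsum V2 vX vY x y E2 K c =
      t True * tsum V3 vX vY x y E3 (insert {vX, vB} K) c + t False * tsum V3 vX vY x y E3 K c"
    if "K \<subseteq> {{vX, vA}}" for K
  proof -
    have "{vX, vB} \<notin> {{vX, vA}}" by (simp add: doubleton_eq_iff)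
    then have "{vX, vB} \<notin> K"
      using subsetD[OF that] by (rule contrapos_nn)
    moreover have "K \<subseteq> {{vX, vA}, {vX, vB}, {vA, vY}, {vB, vY}, {vA, vB}}"
      by (rule subset_trans[OF that]) simp
    ultimately show ?thesis
      unfolding V2_def E2_def using step[of V3 E3 K C2] g3 sub V E by simp
  qed
  have s3: "tsum V3 vX vY x y E3 K c =
      t True * tsum V4 vX vY x y E4 (insert {vA, vY} K) c + t False * tsum V4 vX vY x y E4 K c"
    if "K \<subseteq> {{vX, vA}, {vX, vB}}" for K
  proof -
    have "{vA, vY} \<notin> {{vX, vA}, {vX, vB}}" by (simp add: doubleton_eq_iff)
    then have "{vA, vY} \<notin> K"
      using subsetD[OF that] by (rule contrapos_nn)
    moreover have "K \<subseteq> {{vX, vA}, {vX, vB}, {vA, vY}, {vB, vY}, {vA, vB}}"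
      by (rule subset_trans[OF that]) simp
    ultimately show ?thesis
      unfolding V3_def E3_def using step[of V4 E4 K C3] g4 sub V E by simp
  qed
  have s4: "tsum V4 vX vY x y E4 K c =
      t True * tsum core vX vY x y {{vA, vB}} (insert {vB, vY} K) c + t False * tsum core vX vY x y {{vA, vB}} K c"
    if "K \<subseteq> {{vX, vA}, {vX, vB}, {vA, vY}}" for K
  proof -
    have "{vB, vY} \<notin> {{vX, vA}, {vX, vB}, {vA, vY}}" by (simp add: doubleton_eq_iff)
    then have "{vB, vY} \<notin> K"
      using subsetD[OF that] by (rule contrapos_nn)
    moreover have "K \<subseteq> {{vX, vA}, {vX, vB}, {vA, vY}, {vB, vY}, {vA, vB}}"
      by (rule subset_trans[OF that]) simp
    ultimately show ?thesis
      unfolding V4_def E4_def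
      using step[of core "{{vA, vB}}" K C4] \<open>graph_on core {{vA, vB}}\<close> by (simp add: doubleton_eq_iff)
  qed
  have "tsum_Gn x y (Suc n) c = tsum (gV C1 \<union> V2) vX vY x y (gE C1 \<union> E2) {} c"
    unfolding tsum_Gn_def VE defs ..
  then show ?thesis
    by (simp add: s1 s2 s3 s4 w1_def w2_def w3_def w_def)
qed

lemma tsum_singleton:
  "tsum V s t x y {{a, b}} K c =
    (if joined K s t = c
     then x ^ (ncomp V K + of_bool c - 2) * y ^ (card K + ncomp V K - card V) else 0) -
    (if joined (insert {a, b} K) s t = c
     then x ^ (ncomp V (insert {a, b} K) + of_bool c - 2) *
          y ^ (card (insert {a, b} K) + ncomp V (insert {a, b} K) - card V) else 0)"
  unfolding tsum_def Pow_singleton by (subst sum.insert) (auto simp: insert_commute)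

text \<open>For a single edge all exponents vanish, which leaves the bare signs at every
  \<open>(x, y)\<close>.\<close>

lemma tsum_Gn_0:
  "tsum_Gn x y 0 c = (if c then -1 else 1)"
  by (auto simp: tsum_Gn_def tsum_def Pow_singleton ncomp_insert' ncomp_empty joined_insert)

text \<open>The terms with and without the edge \<open>{vA, vB}\<close> cancel whenever the kept
  cycle edges already join A and B. For connected subgraphs this leaves one cycle edge at X and one
  at Y, chosen in four ways and completed by \<open>{vA, vB}\<close>: hence the factor -4.\<close>

lemma tsum_Gn_0_1_Suc:
  defines "t \<equiv> tsum_Gn 0 1"
  shows "t (Suc n) True = - 4 * (t n True)\<^sup>2 * (t n False)\<^sup>2"
    and "t (Suc n) False = 2 * t n True * (t n False)\<^sup>2 * (t n True - 2 * t n False)"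
  unfolding t_def tsum_Gn_Suc
  by (simp_all add: tsum_singleton ncomp_insert' ncomp_empty joined_insert doubleton_eq_iff)
    algebra+

text \<open>Here the terms with and without \<open>{vA, vB}\<close> cancel when that edge neither
  closes a cycle nor changes whether X and Y are joined. With C, S for the values at
  \<open>True\<close>, \<open>False\<close>, the substitution (C, S) -> (-S, -C) turns
  \<open>tsum_Gn_0_1_Suc\<close> into this recursion.\<close>

lemma tsum_Gn_1_0_Suc:
  defines "t \<equiv> tsum_Gn 1 0"
  shows "t (Suc n) True = 4 * t n True ^ 3 * t n False - 2 * (t n True)\<^sup>2 * (t n False)\<^sup>2"
    and "t (Suc n) False = 4 * (t n True)\<^sup>2 * (t n False)\<^sup>2"
  unfolding t_def tsum_Gn_Suc
  by (simp_all add: tsum_singleton ncomp_insert' ncomp_empty joined_insert doubleton_eq_iff)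
    algebra+

section \<open>The Tutte polynomial of \<open>G\<^sub>n\<close>\<close>

text \<open>A connected \<open>F\<close> has nullity |F| - (|V| - 1), so its sign is that of |F| up
  to a constant. The resulting signed sum is where the Tutte polynomial, the orientation count and
  the 2-sum recursion meet.\<close>

lemma tutte_1_0:
  fixes G :: "'a ugraph"
  defines "V \<equiv> verts G" and "E \<equiv> edges G"
  assumes G: "graph_on V E" "ncomp V E = 1"
  shows "tutte G 1 (0 :: real) = (-1) ^ (card V - 1) * (\<Sum>F\<in>Pow E. if ncomp V F = 1 then (-1) ^ card F else 0)"
proof -
  have fin: "finite V" using G by (auto dest: graph_on_finite)
  have "V \<noteq> {}" using G(2) by (auto simp: ncomp_cls)
  then obtain r where r: "r \<in> V" by blast
  have "(0 :: real) ^ (rank G - rank (G\<lparr>edges := F\<rparr>)) * (- 1) ^ nullity (G\<lparr>edges := F\<rparr>) =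
      (-1) ^ (card V - 1) * (if ncomp V F = 1 then (-1) ^ card F else 0)" if F: "F \<in> Pow E" for F
  proof -
    have g: "graph_on V F" using G(1) F by (auto intro: graph_on_subset)
    have c: "1 \<le> ncomp V F" "ncomp V F \<le> card V" "card V \<le> card F + ncomp V F"
      using two_le_ncomp[OF fin r r, of F] ncomp_le_card[OF fin, of F] card_le_ncomp[OF g] by auto
    have rk: "rank G - rank (G\<lparr>edges := F\<rparr>) = ncomp V F - 1"
      using c G(2) by (simp add: rank_def num_components_eq V_def E_def)
    have nl: "nullity (G\<lparr>edges := F\<rparr>) = card F + ncomp V F - card V"
      by (simp add: nullity_def num_components_eq V_def)
    show ?thesis
    proof (cases "ncomp V F = 1")
      case True
      then have "card F = nullity (G\<lparr>edges := F\<rparr>) + (card V - 1)" using nl c by linarith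
      then show ?thesis using True rk by (simp add: power_add)
    next
      case False
      then show ?thesis using c rk by (simp add: power_0_left)
    qed
  qed
  then show ?thesis
    unfolding tutte_def sum_distrib_left by (intro sum.cong) (simp_all add: E_def)
qed

text \<open>For a forest the rank defect \<open>ncomp V F - 1\<close> and |F| add up to |V| - 1,
  which turns the sign of one into that of the other.\<close>

lemma tutte_0_1:
  fixes G :: "'a ugraph"
  defines "V \<equiv> verts G" and "E \<equiv> edges G"
  assumes G: "graph_on V E" "ncomp V E = 1"
  shows "tutte G (0 :: real) 1 =
    (-1) ^ (card V - 1) * (\<Sum>F\<in>Pow E. if card F + ncomp V F = card V then (-1) ^ card F else 0)"
proof -
  have fin: "finite V" using G by (auto dest: graph_on_finite)
  have "V \<noteq> {}" using G(2) by (auto simp: ncomp_cls)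
  then obtain r where r: "r \<in> V" by blast
  have "(- 1 :: real) ^ (rank G - rank (G\<lparr>edges := F\<rparr>)) * 0 ^ nullity (G\<lparr>edges := F\<rparr>) =
      (-1) ^ (card V - 1) * (if card F + ncomp V F = card V then (-1) ^ card F else 0)" if F: "F \<in> Pow E" for F
  proof -
    have g: "graph_on V F" using G(1) F by (auto intro: graph_on_subset)
    have c: "1 \<le> ncomp V F" "ncomp V F \<le> card V" "card V \<le> card F + ncomp V F"
      using two_le_ncomp[OF fin r r, of F] ncomp_le_card[OF fin, of F] card_le_ncomp[OF g] by auto
    have rk: "rank G - rank (G\<lparr>edges := F\<rparr>) = ncomp V F - 1"
      using c G(2) by (simp add: rank_def num_components_eq V_def E_def)
    have nl: "nullity (G\<lparr>edges := F\<rparr>) = card F + ncomp V F - card V"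
      by (simp add: nullity_def num_components_eq V_def)
    show ?thesis
    proof (cases "card F + ncomp V F = card V")
      case True
      then have "card V - 1 = (ncomp V F - 1) + card F" using c by linarith
      then show ?thesis using True rk nl by (simp add: power_add power_mult_distrib[symmetric])
    next
      case False
      then show ?thesis using c nl by (simp add: power_0_left)
    qed
  qed
  then show ?thesis
    unfolding tutte_def sum_distrib_left by (intro sum.cong) (simp_all add: E_def)
qed

lemma ncomp_Gn: "ncomp (verts (Gn n)) (edges (Gn n)) = 1"
proof -
  have "joined (edges (Gn n)) vX v" if "v \<in> verts (Gn n)" for v
    using that
  proof (induction n arbitrary: v)
    case 0
    then show ?case by (auto intro: joined_edge)
  next
    case (Suc n)
    have copy: "joined (edges (Gn (Suc n))) (glue i u) (glue i w)" if "u \<in> verts (Gn n)" "w \<in> verts (Gn n)" for i u w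
    proof -
      have "joined (edges (Gn n)) u w" using Suc.IH that joined_sym joined_trans by metis
      then have "joined ((`) (glue i) ` edges (Gn n)) (glue i u) (glue i w)"
        using joined_image[OF graph_on_Gn inj_glue] by blast
      then show ?thesis by (rule joined_mono) auto
    qed
    have A: "joined (edges (Gn (Suc n))) vX vA" "joined (edges (Gn (Suc n))) vX vB"
      using copy[of vX vY C1] copy[of vX vY C2] special_in_Gn[of n] by simp_all
    have X: "joined (edges (Gn (Suc n))) vX (glue i vX)" for i
      using A by (cases i) auto
    obtain i w where "v = glue i w" "w \<in> verts (Gn n)" using Suc.prems by auto
    then show ?case using copy[of vX w i] X[of i] special_in_Gn[of n] joined_trans by metis
  qed
  then show ?thesis using ncomp_eq_1_iff[OF finite_Gn(1) special_in_Gn(1)] by blast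
qed

text \<open>A step turns |V| into 4 (|V| - 2) + 4. The parity fixes the sign
  \<open>(-1) ^ (card V - 1)\<close> as -1.\<close>

lemma even_card_verts_Gn: "even (card (verts (Gn n)))"
proof (induction n)
  case (Suc n)
  let ?W = "verts (Gn n) - {vX, vY}"
  have split: "glue i ` verts (Gn n) = {glue i vX, glue i vY} \<union> Inner i ` ?W" for i
  proof -
    have "verts (Gn n) = {vX, vY} \<union> ?W" using special_in_Gn[of n] by auto
    then have "glue i ` verts (Gn n) = {glue i vX, glue i vY} \<union> glue i ` ?W" by (metis image_Un image_empty image_insert)
    moreover have "glue i v = Inner i v" if "v \<in> ?W" for v using that by (cases i; cases v) auto
    ultimately show ?thesis by simp
  qed
  have "verts (Gn (Suc n)) = core \<union> (\<Union>i. Inner i ` ?W)"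
    unfolding Gn.simps ugraph.simps split by (auto simp: UNIV_copy)
  also have "card \<dots> = card core + card (\<Union>i. Inner i ` ?W)"
    by (intro card_Un_disjoint) (auto simp: finite_Gn UNIV_copy)
  also have "card (\<Union>i. Inner i ` ?W) = (\<Sum>i\<in>UNIV. card (Inner i ` ?W))"
    by (intro card_UN_disjoint) (auto simp: finite_Gn UNIV_copy)
  also have "\<dots> = 4 * card ?W"
    by (simp add: UNIV_copy card_image inj_on_def)
  finally show ?case by simp
qed simp

text \<open>A single component forces X and Y to be joined, so the part with index
  \<open>True\<close> is the whole sum over connected subgraphs.\<close>

lemma tutte_Gn_1_0_tsum: "tutte (Gn n) 1 (0 :: real) = - tsum_Gn 0 1 n True"
proof -
  have odd: "odd (card (verts (Gn n)) - 1)"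
    using even_card_verts_Gn[of n] special_in_Gn[of n] finite_Gn(1)[of n] by (auto simp: card_gt_0_iff)
  have eq: "(if joined F vX vY = True then (- 1) ^ card F * (0 :: real) ^ (ncomp V F + of_bool True - 2) * 1 ^ k else 0) =
      (if ncomp V F = 1 then (- 1) ^ card F else 0)" if "V = verts (Gn n)" for F V k
    using two_le_ncomp[OF finite_Gn(1) special_in_Gn, of n F] unfolding that
    by (cases "joined F vX vY"; cases "ncomp (verts (Gn n)) F = 1") (auto simp: power_0_left)
  show ?thesis
    unfolding tutte_1_0[OF graph_on_Gn ncomp_Gn] tsum_Gn_def tsum_def Un_empty_right eq[OF refl]
    using odd by simp
qed

lemma tutte_Gn_0_1_tsum: "tutte (Gn n) (0 :: real) 1 = - (tsum_Gn 1 0 n True + tsum_Gn 1 0 n False)"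
proof -
  have odd: "odd (card (verts (Gn n)) - 1)"
    using even_card_verts_Gn[of n] special_in_Gn[of n] finite_Gn(1)[of n] by (auto simp: card_gt_0_iff)
  have eq: "(0 :: real) ^ (card F + ncomp (verts (Gn n)) F - card (verts (Gn n))) =
      of_bool (card F + ncomp (verts (Gn n)) F = card (verts (Gn n)))" if "F \<in> Pow (edges (Gn n))" for F
  proof -
    have "card (verts (Gn n)) \<le> card F + ncomp (verts (Gn n)) F"
      using that by (intro card_le_ncomp graph_on_subset[OF graph_on_Gn]) auto
    then show ?thesis by (simp add: power_0_left)
  qed
  show ?thesis
    unfolding tutte_0_1[OF graph_on_Gn ncomp_Gn] tsum_Gn_def tsum_def sum.distrib[symmetric]
    unfolding sum_negf[symmetric] sum_distrib_left
    using odd by (intro sum.cong refl) (simp add: eq)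
qed

section \<open>Closed forms\<close>

lemma prod_recursion:
  fixes n :: nat
  defines "p \<equiv> \<lambda>n. \<Prod>i=0..n. (real i + 1) ^ (2 * 4 ^ (n - i))"
  shows "p (Suc n) = p n ^ 4 * (real n + 2)\<^sup>2"
proof -
  have "(\<Prod>i=0..n. (real i + 1) ^ (2 * 4 ^ (Suc n - i))) = (\<Prod>i=0..n. ((real i + 1) ^ (2 * 4 ^ (n - i))) ^ 4)"
    by (intro prod.cong) (auto simp: Suc_diff_le mult_ac simp flip: power_mult)
  then show ?thesis by (simp add: p_def prod_power_distrib power2_eq_square add_ac)
qed

lemma tsum_Gn_closed:
  fixes n :: nat
  defines "p \<equiv> \<Prod>i=0..n. (real i + 1) ^ (2 * 4 ^ (n - i))"
  shows "tsum_Gn 0 1 n True = - p" "tsum_Gn 0 1 n False = (real n + 2) / 2 * p"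
    "tsum_Gn 1 0 n True = - ((real n + 2) / 2) * p" "tsum_Gn 1 0 n False = p"
  unfolding p_def
proof (induction n)
  case 0
  { case 1 show ?case by (simp add: tsum_Gn_0) next case 2 show ?case by (simp add: tsum_Gn_0)
    next case 3 show ?case by (simp add: tsum_Gn_0) next case 4 show ?case by (simp add: tsum_Gn_0) }
next
  case (Suc n)
  define q where "q = (\<Prod>i=0..n. (real i + 1) ^ (2 * 4 ^ (n - i)))"
  note IH = Suc[folded q_def]
  note simps = tsum_Gn_0_1_Suc tsum_Gn_1_0_Suc IH prod_recursion q_def[symmetric]
  { case 1 show ?case unfolding simps by (simp add: field_simps power2_eq_square power4_eq_xxxx)
    next case 2 show ?case unfolding simps by (simp add: field_simps power2_eq_square power4_eq_xxxx)
    next case 3 show ?case unfolding simps by (simp add: field_simps power2_eq_square power3_eq_cube power4_eq_xxxx)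
    next case 4 show ?case unfolding simps by (simp add: field_simps power2_eq_square power4_eq_xxxx) }
qed

lemma tutte_Gn:
  fixes n :: nat
  defines "p \<equiv> \<Prod>i=0..n. (real i + 1) ^ (2 * 4 ^ (n - i))"
  shows "tutte (Gn n) 1 0 = p" "tutte (Gn n) 0 1 = real n / 2 * p"
  unfolding tutte_Gn_1_0_tsum tutte_Gn_0_1_tsum tsum_Gn_closed p_def by (simp_all add: field_simps)

section \<open>Acyclic root-connected orientations\<close>

definition orients :: "'a set set \<Rightarrow> ('a \<times> 'a) set \<Rightarrow> bool" where
  "orients E D \<longleftrightarrow> bij_betw (\<lambda>(u, v). {u, v}) D E"

lemma orients_edge: "orients E D \<Longrightarrow> (u, v) \<in> D \<Longrightarrow> {u, v} \<in> E"
  unfolding orients_def by (drule (1) bij_betw_apply) simp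

lemma orients_empty: "orients {} D \<longleftrightarrow> D = {}"
  using bij_betw_empty2[of _ D] by (fastforce simp: orients_def bij_betw_def)

lemma orients_cases:
  assumes "orients E D" "{u, v} \<in> E"
  shows "(u, v) \<in> D \<or> (v, u) \<in> D"
proof -
  have "{u, v} \<in> (\<lambda>(u, v). {u, v}) ` D" using assms by (simp add: orients_def bij_betw_def)
  then obtain a b where "(a, b) \<in> D" "{u, v} = {a, b}" by auto
  then show ?thesis by (auto simp: doubleton_eq_iff)
qed

lemma orients_insert:
  assumes "orients E D" "{u, v} \<notin> E"
  shows "orients (insert {u, v} E) (insert (u, v) D)"
proof -
  have "(u, v) \<notin> D" using orients_edge[OF assms(1)] assms(2) by blast
  then show ?thesis
    using notIn_Un_bij_betw[of "(u, v)" D "\<lambda>(u, v). {u, v}" E] assms by (simp add: orients_def)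
qed

lemma orients_remove:
  assumes "orients E D" "(u, v) \<in> D"
  shows "orients (E - {{u, v}}) (D - {(u, v)})"
proof -
  have "bij_betw (\<lambda>(u, v). {u, v}) {(u, v)} {{u, v}}" by (simp add: bij_betw_def)
  then show ?thesis
    using bij_betw_DiffI[of "\<lambda>(u, v). {u, v}" D E] assms orients_edge[OF assms] by (simp add: orients_def)
qed

lemma finite_orients:
  assumes "graph_on V E" shows "finite {D. orients E D}"
proof -
  have "{D. orients E D} \<subseteq> Pow (V \<times> V)"
    using assms orients_edge unfolding graph_on_def by fastforce
  then show ?thesis using graph_on_finite[OF assms] by (auto intro: finite_subset)
qed

text \<open>\<open>R\<close> stands for one contracted source vertex. Forbidding arcs into
  \<open>R\<close> also rules out any orientation of an edge inside \<open>R\<close>, as befits a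
  loop of the contracted graph.\<close>

definition rooted_acyclic :: "'a set \<Rightarrow> 'a set \<Rightarrow> 'a set set \<Rightarrow> ('a \<times> 'a) set set" where
  "rooted_acyclic V R E =
     {D. orients E D \<and> acyclic D \<and> D \<inter> UNIV \<times> R = {} \<and> (\<forall>v\<in>V. \<exists>r\<in>R. (r, v) \<in> D\<^sup>*)}"

lemma acyclic_insert_source:
  assumes "acyclic D" "D \<inter> UNIV \<times> {r} = {}" "r \<noteq> v"
  shows "acyclic (insert (r, v) D)"
proof -
  have "(v, r) \<notin> D\<^sup>*" using assms(2,3) by (auto elim: rtranclE)
  then show ?thesis using assms(1) by (simp add: acyclic_insert)
qed

text \<open>Remove the arc \<open>(r, v)\<close>. If \<open>v\<close> keeps an incoming arc,
  acyclicity makes its tail reachable from a root without passing through \<open>v\<close>, so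
  \<open>R\<close> still reaches everything; otherwise \<open>v\<close> becomes a root.\<close>

lemma rooted_acyclic_step:
  assumes G: "graph_on V E" and e: "{r, v} \<in> E" "r \<in> R" "v \<notin> R"
  defines "E' \<equiv> E - {{r, v}}"
  shows "rooted_acyclic V R E = insert (r, v) ` (rooted_acyclic V R E' \<union> rooted_acyclic V (insert v R) E')"
proof (intro equalityI subsetI)
  fix D assume D: "D \<in> rooted_acyclic V R E"
  then have o: "orients E D" and ac: "acyclic D" and no: "D \<inter> UNIV \<times> R = {}"
    and reach: "\<forall>v\<in>V. \<exists>r\<in>R. (r, v) \<in> D\<^sup>*"
    by (auto simp: rooted_acyclic_def)
  have rv: "(r, v) \<in> D" using orients_cases[OF o e(1)] no e(2) by auto
  define D' where "D' = D - {(r, v)}"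
  have D': "D = insert (r, v) D'" "orients E' D'" "acyclic D'" "D' \<inter> UNIV \<times> R = {}"
    using rv no acyclic_subset[OF ac, of D'] orients_remove[OF o rv] by (auto simp: D'_def E'_def)
  have reach': "(\<exists>s\<in>R. (s, w) \<in> D'\<^sup>*) \<or> (v, w) \<in> D'\<^sup>*" if "w \<in> V" for w
    using reach that unfolding D'(1) rtrancl_insert by blast
  have "D' \<in> rooted_acyclic V R E' \<union> rooted_acyclic V (insert v R) E'"
  proof (cases "\<exists>u. (u, v) \<in> D'")
    case True
    then obtain u where u: "(u, v) \<in> D'" by blast
    then have "{u, v} \<in> E" using orients_edge[OF o] D'(1) by auto
    then have "u \<in> V" using G by (auto simp: graph_on_def)
    have "(v, u) \<notin> D'\<^sup>*"
    proof
      assume "(v, u) \<in> D'\<^sup>*"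
      then have "(v, v) \<in> D'\<^sup>+" using u by (rule rtrancl_into_trancl1)
      then show False using D'(3) by (simp add: acyclic_def)
    qed
    then obtain s where "s \<in> R" "(s, v) \<in> D'\<^sup>*"
      using reach'[OF \<open>u \<in> V\<close>] u by (meson rtrancl.rtrancl_into_rtrancl)
    then have "\<forall>w\<in>V. \<exists>s\<in>R. (s, w) \<in> D'\<^sup>*" using reach' by (meson rtrancl_trans)
    then show ?thesis using D' by (simp add: rooted_acyclic_def)
  next
    case False
    then have "D' \<inter> UNIV \<times> insert v R = {}" using D'(4) by auto
    moreover have "\<forall>w\<in>V. \<exists>s\<in>insert v R. (s, w) \<in> D'\<^sup>*" using reach' by blast
    ultimately show ?thesis using D' by (simp add: rooted_acyclic_def)
  qed
  then show "D \<in> insert (r, v) ` (rooted_acyclic V R E' \<union> rooted_acyclic V (insert v R) E')"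
    using D'(1) by blast
next
  fix D assume "D \<in> insert (r, v) ` (rooted_acyclic V R E' \<union> rooted_acyclic V (insert v R) E')"
  then obtain D' where D: "D = insert (r, v) D'"
    and "D' \<in> rooted_acyclic V R E' \<or> D' \<in> rooted_acyclic V (insert v R) E'" by blast
  then have D': "orients E' D'" "acyclic D'" "D' \<inter> UNIV \<times> R = {}"
    and reach: "\<forall>w\<in>V. \<exists>s\<in>insert v R. (s, w) \<in> D'\<^sup>*"
    by (auto simp: rooted_acyclic_def)
  have "E = insert {r, v} E'" using e by (auto simp: E'_def)
  then have "orients E D" using orients_insert[OF D'(1), of r v] by (simp add: D E'_def)
  moreover have "acyclic D"
    unfolding D using D' e by (intro acyclic_insert_source) auto
  moreover have "D \<inter> UNIV \<times> R = {}" using D'(3) e by (auto simp: D)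
  moreover have "\<exists>s\<in>R. (s, w) \<in> D\<^sup>*" if w: "w \<in> V" for w
  proof -
    obtain s where s: "s = v \<or> s \<in> R" "(s, w) \<in> D'\<^sup>*" using reach w by auto
    have "(s, w) \<in> D\<^sup>*" using s(2) rtrancl_mono[of D' D] D by blast
    moreover have "(r, v) \<in> D" by (simp add: D)
    ultimately show ?thesis using s(1) e(2) by (meson converse_rtrancl_into_rtrancl)
  qed
  ultimately show "D \<in> rooted_acyclic V R E" by (simp add: rooted_acyclic_def)
qed

lemma card_rooted_acyclic_step:
  assumes G: "graph_on V E" and e: "{r, v} \<in> E" "r \<in> R" "v \<notin> R"
  defines "E' \<equiv> E - {{r, v}}"
  shows "card (rooted_acyclic V R E) = card (rooted_acyclic V R E') + card (rooted_acyclic V (insert v R) E')"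
proof -
  have "v \<in> V" using G e(1) by (auto simp: graph_on_def)
  have fin: "finite (rooted_acyclic V R' E')" for R'
    using finite_orients[OF graph_on_subset[OF G, of E']] by (auto simp: rooted_acyclic_def E'_def)
  have notin: "(r, v) \<notin> D'" if "D' \<in> rooted_acyclic V R E' \<union> rooted_acyclic V (insert v R) E'" for D'
    using that orients_edge[of E' D' r v] by (auto simp: rooted_acyclic_def E'_def)
  have "inj_on (insert (r, v)) (rooted_acyclic V R E' \<union> rooted_acyclic V (insert v R) E')"
    by (rule inj_onI) (use notin in \<open>metis insert_ident\<close>)
  then have "card (rooted_acyclic V R E) = card (rooted_acyclic V R E' \<union> rooted_acyclic V (insert v R) E')"
    unfolding rooted_acyclic_step[OF assms(1-4), folded E'_def] by (rule card_image)
  \<comment> \<open>With roots \<open>R\<close> the vertex \<open>v\<close> is reached and so has an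
    incoming arc; as a root it has none.\<close>
  also have "rooted_acyclic V R E' \<inter> rooted_acyclic V (insert v R) E' = {}"
  proof (rule ccontr)
    assume "rooted_acyclic V R E' \<inter> rooted_acyclic V (insert v R) E' \<noteq> {}"
    then obtain D where D: "D \<in> rooted_acyclic V R E'" "D \<in> rooted_acyclic V (insert v R) E'" by blast
    then obtain s where "s \<in> R" "(s, v) \<in> D\<^sup>*" using \<open>v \<in> V\<close> by (auto simp: rooted_acyclic_def)
    then obtain u where "(u, v) \<in> D" using e(3) by (metis rtranclE)
    then show False using D(2) by (auto simp: rooted_acyclic_def)
  qed
  then have "card (rooted_acyclic V R E' \<union> rooted_acyclic V (insert v R) E') =
      card (rooted_acyclic V R E') + card (rooted_acyclic V (insert v R) E')"
    by (rule card_Un_disjoint[OF fin fin])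
  finally show ?thesis .
qed

section \<open>Signed subgraph sums under deletion and contraction\<close>

lemma sum_Pow_insert:
  fixes h :: "'a set \<Rightarrow> 'b :: comm_monoid_add"
  assumes "finite E" "e \<in> E"
  shows "(\<Sum>F\<in>Pow E. h F) = (\<Sum>F\<in>Pow (E - {e}). h F) + (\<Sum>F\<in>Pow (E - {e}). h (insert e F))"
proof -
  have "(\<Sum>F\<in>Pow E. h F) = (\<Sum>F\<in>Pow ({e} \<union> (E - {e})). h F)" using assms by (simp add: insert_absorb)
  also have "\<dots> = (\<Sum>F\<in>Pow {e}. \<Sum>F'\<in>Pow (E - {e}). h (F \<union> F'))" by (rule sum_Pow_Un) auto
  finally show ?thesis by (simp add: Pow_singleton)
qed

lemma card_insert_Pow:
  assumes "finite E" "F \<in> Pow (E - {e})"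
  shows "card (insert e F) = Suc (card F)"
proof -
  have "finite F" using assms by (meson PowD finite_Diff finite_subset)
  moreover have "e \<notin> F" using assms(2) by blast
  ultimately show ?thesis by simp
qed

lemma reaches_insert_root:
  assumes "r \<in> R"
  shows "(\<forall>w\<in>V. \<exists>s\<in>R. joined (insert {r, v} F) s w) \<longleftrightarrow> (\<forall>w\<in>V. \<exists>s\<in>insert v R. joined F s w)"
proof -
  have "(\<exists>s\<in>R. joined (insert {r, v} F) s w) \<longleftrightarrow> (\<exists>s\<in>insert v R. joined F s w)" for w
    using assms unfolding joined_insert by (auto intro: joined_refl)
  then show ?thesis by simp
qed

text \<open>Both sides obey deletion and contraction of an edge leaving \<open>R\<close>: subgraphs
  with the edge have one edge more, and the contraction has one non-root less, so the signs match.
  If no edge leaves \<open>R\<close>, either all vertices are roots or both sides vanish.\<close>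

theorem card_rooted_acyclic:
  assumes "graph_on V E" "R \<subseteq> V"
  shows "real (card (rooted_acyclic V R E)) =
    (-1) ^ card (V - R) * (\<Sum>F\<in>Pow E. if \<forall>w\<in>V. \<exists>s\<in>R. joined F s w then (-1) ^ card F else 0)"
  using assms
proof (induction "card E" arbitrary: E R rule: less_induct)
  case less
  have finE: "finite E" and finV: "finite V" using less.prems by (auto dest: graph_on_finite)
  show ?case
  proof (cases "\<exists>r v. {r, v} \<in> E \<and> r \<in> R \<and> v \<notin> R")
    case True
    then obtain r v where e: "{r, v} \<in> E" "r \<in> R" "v \<notin> R" by blast
    define E' where "E' = E - {{r, v}}"
    have v: "v \<in> V" using less.prems(1) e(1) by (auto simp: graph_on_def)
    have "E' \<subset> E" using e(1) by (auto simp: E'_def)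
    then have lt: "card E' < card E" using finE by (rule psubset_card_mono[rotated])
    have g: "graph_on V E'" using less.prems(1) by (auto simp: E'_def intro: graph_on_subset)
    have sgn: "card (V - R) = Suc (card (V - insert v R))"
      using finV v e(3) by (metis Diff_insert card_Suc_Diff1 DiffI finite_Diff)
    have card_ins: "card (insert {r, v} F) = Suc (card F)" if "F \<in> Pow E'" for F
      using card_insert_Pow[OF finE] that by (simp add: E'_def)
    have "real (card (rooted_acyclic V R E)) =
        real (card (rooted_acyclic V R E')) + real (card (rooted_acyclic V (insert v R) E'))"
      using card_rooted_acyclic_step[OF less.prems(1) e] by (simp add: E'_def)
    also have "\<dots> = (-1) ^ card (V - R) * (\<Sum>F\<in>Pow E'. if \<forall>w\<in>V. \<exists>s\<in>R. joined F s w then (-1) ^ card F else 0)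
      + (-1) ^ card (V - insert v R) * (\<Sum>F\<in>Pow E'. if \<forall>w\<in>V. \<exists>s\<in>insert v R. joined F s w then (-1) ^ card F else 0)"
      using less.hyps[OF lt g] less.prems(2) v by simp
    also have "(\<Sum>F\<in>Pow E'. if \<forall>w\<in>V. \<exists>s\<in>insert v R. joined F s w then (-1) ^ card F else (0 :: real)) =
      - (\<Sum>F\<in>Pow E'. if \<forall>w\<in>V. \<exists>s\<in>R. joined (insert {r, v} F) s w then (-1) ^ card (insert {r, v} F) else 0)"
      unfolding sum_negf[symmetric]
      by (intro sum.cong refl) (simp add: card_ins reaches_insert_root[OF e(2)])
    finally show ?thesis
      unfolding sum_Pow_insert[OF finE e(1)] E'_def[symmetric] sgn by (simp add: algebra_simps)
  next
    case False
    have closed: "w \<in> R" if "s \<in> R" "joined F s w" "F \<subseteq> E" for s w F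
      using that(2) by (induction rule: joined_induct) (use False that in auto)
    show ?thesis
    proof (cases "R = V")
      case True
      have all: "\<forall>w\<in>V. \<exists>s\<in>R. joined F s w" for F using True joined_refl by metis
      show ?thesis
      proof (cases "E = {}")
        case E: True
        have "rooted_acyclic V R E = {{}}"
          using True by (auto simp: rooted_acyclic_def E orients_empty acyclic_def)
        then show ?thesis using True by (auto simp: E)
      next
        case E: False
        then obtain e where "e \<in> E" by blast
        then obtain a b where ab: "e = {a, b}" "{a, b} \<in> E" "a \<in> R" "b \<in> R"
          using graph_on_edgeE[OF less.prems(1)] True by metis
        have "rooted_acyclic V R E = {}"
          using orients_cases[OF _ ab(2)] ab by (auto simp: rooted_acyclic_def)
        \<comment> \<open>All subgraphs count here, and toggling one fixed edge pairs them with
          opposite signs.\<close>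
        moreover have "(\<Sum>F\<in>Pow E. (-1 :: real) ^ card F) = 0"
        proof -
          have "card (insert {a, b} F) = Suc (card F)" if "F \<in> Pow (E - {{a, b}})" for F
            using card_insert_Pow[OF finE] that by simp
          then show ?thesis
            unfolding sum_Pow_insert[OF finE ab(2)] by (simp add: sum_negf)
        qed
        ultimately show ?thesis using all by simp
      qed
    next
      case False
      then obtain w where w: "w \<in> V" "w \<notin> R" using less.prems(2) by blast
      have "rooted_acyclic V R E = {}"
      proof (rule ccontr)
        assume "rooted_acyclic V R E \<noteq> {}"
        then obtain D s where D: "orients E D" "s \<in> R" "(s, w) \<in> D\<^sup>*"
          using w by (auto simp: rooted_acyclic_def)
        have "D\<^sup>* \<subseteq> {(a, b). {a, b} \<in> E}\<^sup>*"
          using orients_edge[OF D(1)] by (intro rtrancl_mono) auto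
        then have "joined E s w" using D(3) by (auto simp: joined_def)
        then show False using closed[of s E w] D w by auto
      qed
      moreover have "\<not> (\<forall>w\<in>V. \<exists>s\<in>R. joined F s w)" if "F \<in> Pow E" for F
        using closed w that by blast
      then have "(\<Sum>F\<in>Pow E. if \<forall>w\<in>V. \<exists>s\<in>R. joined F s w then (-1) ^ card F else (0 :: real)) = 0"
        by (intro sum.neutral) simp
      ultimately show ?thesis by simp
    qed
  qed
qed

corollary card_acyclic_root_connected:
  fixes G :: "'a ugraph"
  assumes G: "graph_on (verts G) (edges G)" "ncomp (verts G) (edges G) = 1" and r: "r \<in> verts G"
  shows "real (card {D. orientation G D \<and> acyclic D \<and> root_connected G r D}) =
    (-1) ^ (card (verts G) - 1) * (\<Sum>F\<in>Pow (edges G). if ncomp (verts G) F = 1 then (-1) ^ card F else 0)"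
proof -
  have fin: "finite (verts G)" using G(1) by (rule graph_on_finite)
  have no_in: "D \<inter> UNIV \<times> {r} = {}" if "orientation G D" "acyclic D" "root_connected G r D" for D
  proof (rule ccontr)
    assume "D \<inter> UNIV \<times> {r} \<noteq> {}"
    then obtain u where u: "(u, r) \<in> D" by blast
    then have "{u, r} \<in> edges G" using that(1) orients_edge by (auto simp: orientation_def orients_def)
    then have "u \<in> verts G" using G(1) by (auto simp: graph_on_def)
    then have "(r, u) \<in> D\<^sup>*" using that(3) by (auto simp: root_connected_def)
    then have "(r, r) \<in> D\<^sup>+" using u by (rule rtrancl_into_trancl1)
    then show False using that(2) by (simp add: acyclic_def)
  qed
  have "{D. orientation G D \<and> acyclic D \<and> root_connected G r D} = rooted_acyclic (verts G) {r} (edges G)"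
    using no_in by (auto simp: rooted_acyclic_def orientation_def orients_def root_connected_def)
  moreover have "card (verts G - {r}) = card (verts G) - 1" using fin r by simp
  ultimately show ?thesis
    using card_rooted_acyclic[OF G(1), of "{r}"] r ncomp_eq_1_iff[OF fin r] by simp
qed

section \<open>Indegree sequences\<close>

text \<open>\<open>inside\<close> and \<open>touching\<close> bound the total indegree of
  \<open>W\<close> in any orientation; they are integers so that they can be compared with vectors
  \<open>d\<close> of either sign.\<close>

definition inside :: "'a set set \<Rightarrow> 'a set \<Rightarrow> int" where
  "inside E W = int (card {e \<in> E. e \<subseteq> W})"

definition touching :: "'a set set \<Rightarrow> 'a set \<Rightarrow> int" where
  "touching E W = int (card {e \<in> E. e \<inter> W \<noteq> {}})"

lemma inside_empty: "graph_on V E \<Longrightarrow> inside E {} = 0"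
  by (auto simp: inside_def graph_on_def)

lemma touching_empty: "touching E {} = 0"
  by (simp add: touching_def)

lemma inside_plus_touching:
  assumes "graph_on V E" "W \<subseteq> V"
  shows "inside E (V - W) + touching E W = int (card E)"
proof -
  have "card {e \<in> E. e \<subseteq> V - W} + card {e \<in> E. e \<inter> W \<noteq> {}} = card ({e \<in> E. e \<subseteq> V - W} \<union> {e \<in> E. e \<inter> W \<noteq> {}})"
    using graph_on_finite[OF assms(1)] by (intro card_Un_disjoint[symmetric]) auto
  also have "{e \<in> E. e \<subseteq> V - W} \<union> {e \<in> E. e \<inter> W \<noteq> {}} = E"
    using assms by (auto simp: graph_on_def)
  finally show ?thesis by (simp add: inside_def touching_def)
qed

lemma inside_insert:
  assumes "finite F" "{a, b} \<notin> F"
  shows "inside (insert {a, b} F) W = inside F W + of_bool (a \<in> W \<and> b \<in> W)"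
proof (cases "a \<in> W \<and> b \<in> W")
  case True
  then have "{e \<in> insert {a, b} F. e \<subseteq> W} = insert {a, b} {e \<in> F. e \<subseteq> W}" by auto
  then show ?thesis using True assms by (simp add: inside_def)
next
  case False
  then have "{e \<in> insert {a, b} F. e \<subseteq> W} = {e \<in> F. e \<subseteq> W}" by auto
  then show ?thesis using False by (simp add: inside_def)
qed

lemma touching_insert:
  assumes "finite F" "{a, b} \<notin> F"
  shows "touching (insert {a, b} F) W = touching F W + of_bool (a \<in> W \<or> b \<in> W)"
proof (cases "a \<in> W \<or> b \<in> W")
  case True
  then have "{e \<in> insert {a, b} F. e \<inter> W \<noteq> {}} = insert {a, b} {e \<in> F. e \<inter> W \<noteq> {}}" by auto
  then show ?thesis using True assms by (simp add: touching_def)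
next
  case False
  then have "{e \<in> insert {a, b} F. e \<inter> W \<noteq> {}} = {e \<in> F. e \<inter> W \<noteq> {}}" by auto
  then show ?thesis using False by (simp add: touching_def)
qed

lemma inside_supermodular:
  assumes "finite E"
  shows "inside E A + inside E B \<le> inside E (A \<union> B) + inside E (A \<inter> B)"
proof -
  let ?A = "{e \<in> E. e \<subseteq> A}" and ?B = "{e \<in> E. e \<subseteq> B}"
  have "card ?A + card ?B = card (?A \<union> ?B) + card (?A \<inter> ?B)"
    using assms by (intro card_Un_Int) auto
  moreover have "card (?A \<union> ?B) \<le> card {e \<in> E. e \<subseteq> A \<union> B}" using assms by (intro card_mono) auto
  moreover have "?A \<inter> ?B = {e \<in> E. e \<subseteq> A \<inter> B}" by auto
  ultimately show ?thesis by (simp add: inside_def)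
qed

lemma sum_supermodular:
  fixes d :: "'a \<Rightarrow> int"
  assumes "finite A" "finite B"
  shows "sum d A + sum d B = sum d (A \<union> B) + sum d (A \<inter> B)"
  using sum.union_inter[OF assms, of d] by simp

lemma sum_fun_upd:
  fixes d :: "'a \<Rightarrow> int"
  assumes "finite U"
  shows "sum (d(x := c)) U = sum d U + (if x \<in> U then c - d x else 0)"
proof (cases "x \<in> U")
  case True
  then have "sum (d(x := c)) U = c + sum (d(x := c)) (U - {x})" using assms by (simp add: sum.remove)
  also have "sum (d(x := c)) (U - {x}) = sum d (U - {x})" by (intro sum.cong) auto
  finally show ?thesis using True assms by (simp add: sum_diff1)
next
  case False
  then show ?thesis by (auto intro!: sum.cong)
qed

text \<open>If neither direction of the new edge is possible, uncrossing the two tight sets overfills their union.\<close>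

lemma exists_orientation:
  fixes d :: "'a \<Rightarrow> int"
  assumes "graph_on V E" and "\<forall>U\<subseteq>V. inside E U \<le> sum d U" and "sum d V = int (card E)"
  shows "\<exists>D. orients E D \<and> (\<forall>v\<in>V. int (indegrees D v) = d v)"
  using assms
proof (induction arbitrary: d rule: graph_on_induct)
  case empty
  have finV: "finite V" using assms(1) by (rule graph_on_finite)
  have nonneg: "0 \<le> d v" if "v \<in> V" for v
    using empty.prems(1)[rule_format, of "{v}"] that by (simp add: inside_def)
  have "d v = 0" if "v \<in> V" for v
    using empty.prems(2) sum_nonneg_eq_0_iff[OF finV nonneg] that by simp
  then show ?case by (auto simp: orients_empty indegrees_def)
next
  case (insert a b F)
  have finV: "finite V" and finF: "finite F" using insert.hyps(5) by (auto dest: graph_on_finite)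
  have low: "inside F U + of_bool (a \<in> U \<and> b \<in> U) \<le> sum d U" if "U \<subseteq> V" for U
    using insert.prems(1)[rule_format, OF that] by (simp only: inside_insert[OF finF insert.hyps(4)])
  have "\<exists>x y. {y, x} = {a, b} \<and> (\<forall>U\<subseteq>V. inside F U \<le> sum d U - of_bool (x \<in> U))"
  proof (rule ccontr)
    assume no: "\<not> ?thesis"
    have "\<not> (\<forall>U\<subseteq>V. inside F U \<le> sum d U - of_bool (a \<in> U))" using no by (metis insert_commute)
    then obtain A where A: "A \<subseteq> V" "sum d A - of_bool (a \<in> A) < inside F A" by (auto simp: not_le)
    have "\<not> (\<forall>U\<subseteq>V. inside F U \<le> sum d U - of_bool (b \<in> U))" using no by blast
    then obtain B where B: "B \<subseteq> V" "sum d B - of_bool (b \<in> B) < inside F B" by (auto simp: not_le)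
    have a: "a \<in> A" "b \<notin> A" "sum d A \<le> inside F A"
      using A low[OF A(1)] by (auto split: if_splits simp: of_bool_def)
    have b: "b \<in> B" "a \<notin> B" "sum d B \<le> inside F B"
      using B low[OF B(1)] by (auto split: if_splits simp: of_bool_def)
    \<comment> \<open>The union contains both ends, so the new edge raises its lower bound by
      1.\<close>
    have "inside F (A \<union> B) + 1 \<le> sum d (A \<union> B)" using low[of "A \<union> B"] A(1) B(1) a b by simp
    moreover have "inside F (A \<inter> B) \<le> sum d (A \<inter> B)" using low[of "A \<inter> B"] A(1) a b by (simp add: le_infI1)
    moreover have "sum d A + sum d B = sum d (A \<union> B) + sum d (A \<inter> B)"
      using finV A(1) B(1) by (intro sum_supermodular) (auto intro: finite_subset)
    ultimately show False using a(3) b(3) inside_supermodular[OF finF, of A B] by linarith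
  qed
  then obtain x y where xy: "{y, x} = {a, b}" and ok: "\<forall>U\<subseteq>V. inside F U \<le> sum d U - of_bool (x \<in> U)" by blast
  have x: "x \<in> V" using xy insert.hyps(1,2) by (auto simp: doubleton_eq_iff)
  have upd: "sum (d(x := d x - 1)) U = sum d U - of_bool (x \<in> U)" if "U \<subseteq> V" for U
    using sum_fun_upd[OF finite_subset[OF that finV], of d x] by simp
  have "\<exists>D. orients F D \<and> (\<forall>v\<in>V. int (indegrees D v) = (d(x := d x - 1)) v)"
  proof (rule insert.IH)
    show "\<forall>U\<subseteq>V. inside F U \<le> sum (d(x := d x - 1)) U" using ok upd by simp
    show "sum (d(x := d x - 1)) V = int (card F)"
      using upd[of V] x insert.prems(2) finF insert.hyps(4) by simp
  qed
  then obtain D where D: "orients F D" "\<forall>v\<in>V. int (indegrees D v) = (d(x := d x - 1)) v" by blast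
  have notin: "(y, x) \<notin> D" using orients_edge[OF D(1)] insert.hyps(4) xy by metis
  have "finite {u. (u, v) \<in> D}" for v
  proof (rule finite_subset[OF _ finV])
    show "{u. (u, v) \<in> D} \<subseteq> V"
      using orients_edge[OF D(1)] insert.hyps(5) unfolding graph_on_def by blast
  qed
  moreover have "{u. (u, v) \<in> insert (y, x) D} = (if v = x then insert y {u. (u, v) \<in> D} else {u. (u, v) \<in> D})" for v
    by auto
  ultimately have "indegrees (insert (y, x) D) v = indegrees D v + of_bool (v = x)" for v
    using notin by (simp add: indegrees_def)
  moreover have "orients (insert {a, b} F) (insert (y, x) D)"
    using orients_insert[OF D(1), of y x] insert.hyps(4) xy by simp
  ultimately show ?case using D(2) by (intro exI[of _ "insert (y, x) D"]) simp
qed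

text \<open>For \<open>R = {r}\<close> these are the lattice points in the interior of the convex
  hull of the indegree vectors, without the coordinate of \<open>r\<close>, which the total |E|
  determines. A larger \<open>R\<close> stands for a contracted root.\<close>

definition inner_points :: "'a set \<Rightarrow> 'a set \<Rightarrow> 'a set set \<Rightarrow> ('a \<Rightarrow> int) set" where
  "inner_points V R E =
     {d. (\<forall>v. v \<notin> V - R \<longrightarrow> d v = 0) \<and>
         (\<forall>W. W \<subseteq> V - R \<longrightarrow> W \<noteq> {} \<longrightarrow> inside E W < sum d W \<and> sum d W < touching E W)}"

lemma inner_pointsI:
  assumes "\<And>v. v \<notin> V - R \<Longrightarrow> d v = 0"
    and "\<And>W. W \<subseteq> V - R \<Longrightarrow> W \<noteq> {} \<Longrightarrow> inside E W < sum d W"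
    and "\<And>W. W \<subseteq> V - R \<Longrightarrow> W \<noteq> {} \<Longrightarrow> sum d W < touching E W"
  shows "d \<in> inner_points V R E"
proof -
  have "\<forall>v. v \<notin> V - R \<longrightarrow> d v = 0" using assms(1) by blast
  moreover have "\<forall>W. W \<subseteq> V - R \<longrightarrow> W \<noteq> {} \<longrightarrow> inside E W < sum d W \<and> sum d W < touching E W"
    using assms(2,3) by blast
  ultimately show ?thesis unfolding inner_points_def mem_Collect_eq ..
qed

lemma inner_pointsD:
  assumes "d \<in> inner_points V R E"
  shows "v \<notin> V - R \<Longrightarrow> d v = 0"
    and "W \<subseteq> V - R \<Longrightarrow> W \<noteq> {} \<Longrightarrow> inside E W < sum d W"
    and "W \<subseteq> V - R \<Longrightarrow> W \<noteq> {} \<Longrightarrow> sum d W < touching E W"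
  using assms unfolding inner_points_def mem_Collect_eq by blast+

lemma finite_inner_points:
  assumes "graph_on V E" shows "finite (inner_points V R E)"
proof -
  have fin: "finite V" "finite E" using assms by (auto dest: graph_on_finite)
  have "inner_points V R E \<subseteq> {d. \<forall>v. (v \<in> V - R \<longrightarrow> d v \<in> {0..int (card E)}) \<and> (v \<notin> V - R \<longrightarrow> d v = 0)}"
  proof
    fix d assume d: "d \<in> inner_points V R E"
    have "0 \<le> d v \<and> d v \<le> int (card E)" if "v \<in> V - R" for v
    proof -
      have "inside E {v} < d v" "d v < touching E {v}"
        using inner_pointsD(2,3)[OF d, of "{v}"] that by simp_all
      moreover have "touching E {v} \<le> int (card E)" using fin by (auto simp: touching_def intro: card_mono)
      moreover have "0 \<le> inside E {v}" by (simp add: inside_def)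
      ultimately show ?thesis by linarith
    qed
    then show "d \<in> {d. \<forall>v. (v \<in> V - R \<longrightarrow> d v \<in> {0..int (card E)}) \<and> (v \<notin> V - R \<longrightarrow> d v = 0)}"
      using inner_pointsD(1)[OF d] by simp
  qed
  moreover have "finite {d. \<forall>v. (v \<in> V - R \<longrightarrow> d v \<in> {0..int (card E)}) \<and> (v \<notin> V - R \<longrightarrow> d v = 0)}"
    using fin(1) by (intro finite_set_of_finite_funs) simp_all
  ultimately show ?thesis by (rule finite_subset)
qed

text \<open>Every edge counted on the left is counted on the right. The edge \<open>{r, v}\<close>
  is counted only in \<open>touching E B\<close>, because \<open>v\<close> lies in both sets and
  \<open>r\<close> in neither; this is the extra 1.\<close>

lemma inside_touching_cross:
  assumes "finite E" and e: "{r, v} \<in> E" "v \<in> A" "v \<in> B" "r \<notin> A" "r \<notin> B"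
  shows "inside E A + touching E (B - A) + 1 \<le> touching E B + inside E (A - B)"
proof -
  let ?X1 = "{e \<in> E. e \<subseteq> A}" and ?X2 = "{e \<in> E. e \<inter> (B - A) \<noteq> {}}"
    and ?Y1 = "{e \<in> E. e \<inter> B \<noteq> {}}" and ?Y2 = "{e \<in> E. e \<subseteq> A - B}"
  have "card ?X1 + card ?X2 = card (?X1 \<union> ?X2)"
    using assms(1) by (intro card_Un_disjoint[symmetric]) auto
  moreover have "Suc (card (?X1 \<union> ?X2)) = card (insert {r, v} (?X1 \<union> ?X2))"
    using assms by (intro card_insert_disjoint[symmetric]) auto
  moreover have "card (insert {r, v} (?X1 \<union> ?X2)) \<le> card (?Y1 \<union> ?Y2)"
    using assms by (intro card_mono) auto
  moreover have "card (?Y1 \<union> ?Y2) \<le> card ?Y1 + card ?Y2" by (rule card_Un_le)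
  ultimately show ?thesis by (simp add: inside_def touching_def)
qed

lemma joined_crossing:
  assumes "joined F r v" "r \<notin> A" "v \<in> A"
  shows "\<exists>p q. {p, q} \<in> F \<and> p \<notin> A \<and> q \<in> A"
proof (rule ccontr)
  assume no: "\<not> ?thesis"
  from assms(1) have "v \<notin> A" by (induction rule: joined_induct) (use no assms(2) in auto)
  then show False using assms(3) by simp
qed

text \<open>A second connection from \<open>r\<close> to \<open>v\<close> enters \<open>A\<close> by
  an edge other than \<open>{r, v}\<close> and not in \<open>T\<close>, so two edges touch
  \<open>A\<close> without lying inside it.\<close>

lemma inside_touching_nonbridge:
  assumes G: "graph_on V E" and e: "{r, v} \<in> E" "v \<in> A" "r \<notin> A"
    and T: "\<forall>e\<in>T. e \<inter> A = {}" and nb: "joined (E - {{r, v}} \<union> T) r v"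
  shows "inside E A + 2 \<le> touching E A"
proof -
  have fin: "finite E" using G by (rule graph_on_finite)
  obtain p q where pq: "{p, q} \<in> E - {{r, v}} \<union> T" "p \<notin> A" "q \<in> A"
    using joined_crossing[OF nb e(3,2)] by blast
  then have pqE: "{p, q} \<in> E" "{p, q} \<noteq> {r, v}" using T by auto
  let ?I = "{e \<in> E. e \<subseteq> A}"
  have "{p, q} \<notin> ?I" "{r, v} \<notin> insert {p, q} ?I" using e(3) pq(2) pqE(2) by auto
  then have "card ?I + 2 = card (insert {r, v} (insert {p, q} ?I))" using fin by simp
  also have "\<dots> \<le> card {e \<in> E. e \<inter> A \<noteq> {}}"
  proof (intro card_mono)
    have "e' \<noteq> {}" if "e' \<in> E" for e' using G that by (auto simp: graph_on_def)
    then have "?I \<subseteq> {e \<in> E. e \<inter> A \<noteq> {}}" by (auto simp: Int_absorb2)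
    then show "insert {r, v} (insert {p, q} ?I) \<subseteq> {e \<in> E. e \<inter> A \<noteq> {}}"
      using e pqE pq by simp
  qed (use fin in simp)
  finally show ?thesis by (simp add: inside_def touching_def)
qed

lemma inner_points_mono:
  assumes "finite F" "{r, v} \<notin> F" "r \<in> R"
  shows "inner_points V R F \<subseteq> inner_points V R (insert {r, v} F)"
proof
  fix d assume d: "d \<in> inner_points V R F"
  have W: "inside (insert {r, v} F) W = inside F W" "touching F W \<le> touching (insert {r, v} F) W" if "W \<subseteq> V - R" for W
    using that assms(3) inside_insert[OF assms(1,2)] touching_insert[OF assms(1,2)] by auto
  then show "d \<in> inner_points V R (insert {r, v} F)"
    using inner_pointsD(1,2)[OF d] less_le_trans[OF inner_pointsD(3)[OF d] W(2)] W(1)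
    by (intro inner_pointsI) simp_all
qed

text \<open>
  Over each point for the contracted graph, the possible values at \<open>v\<close> form a
  nonempty interval, and deleting the edge removes its maximum.
\<close>

lemma card_inner_points_step:
  assumes G: "graph_on V (insert {r, v} F)" "{r, v} \<notin> F" and r: "r \<in> R" "v \<notin> R"
    and T: "\<forall>e\<in>T. e \<subseteq> R" and nb: "joined (F \<union> T) r v"
  shows "card (inner_points V R (insert {r, v} F)) =
    card (inner_points V R F) + card (inner_points V (insert v R) F)"
proof -
  define E where "E = insert {r, v} F"
  have finV: "finite V" and finE: "finite E" using G by (auto simp: E_def dest: graph_on_finite)
  have finF: "finite F" using finE by (simp add: E_def)
  have v: "v \<in> V" "r \<noteq> v" using G(1) by (auto simp: graph_on_insert)
  have ins: "inside E W = inside F W" if "W \<subseteq> V - R" for W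
    using that r(1) inside_insert[OF finF G(2)] by (auto simp: E_def)
  have tch: "touching E W = touching F W + of_bool (v \<in> W)" if "W \<subseteq> V - R" for W
    using that r(1) touching_insert[OF finF G(2)] by (auto simp: E_def)
  have eqU: "V - insert v R = V - R - {v}" by auto
  have finW: "finite W" if "W \<subseteq> V - R" for W using that finV by (meson finite_Diff finite_subset)
  have upd: "sum (d(v := x)) W = sum d W" if "W \<subseteq> V - R - {v}" for d :: "'a \<Rightarrow> int" and x W
    using that by (intro sum.cong) auto
  have sumv: "sum d (insert v B) = d v + sum d B" if "B \<subseteq> V - R - {v}" for d :: "'a \<Rightarrow> int" and B
    using that finW[of B] by (subst sum.insert) auto

  \<comment> \<open>Forgetting the coordinate at \<open>v\<close> is the projection to the
    contracted graph: the remaining conditions concern sets avoiding \<open>v\<close>, for which the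
    edge is irrelevant.\<close>
  have to: "d(v := 0) \<in> inner_points V (insert v R) F" if d: "d \<in> inner_points V R E" for d
  proof -
    have "inside F W < sum (d(v := 0)) W \<and> sum (d(v := 0)) W < touching F W"
      if W: "W \<subseteq> V - R - {v}" "W \<noteq> {}" for W
    proof -
      have "W \<subseteq> V - R" "v \<notin> W" using W by auto
      then show ?thesis
        using inner_pointsD(2,3)[OF d, of W] W(2) upd[OF W(1), of d 0] ins[of W] tch[of W] by simp
    qed
    then show ?thesis using inner_pointsD(1)[OF d] by (intro inner_pointsI) (auto simp: eqU)
  qed

  \<comment> \<open>Deleting the edge lowers by 1 exactly the upper bounds of sets containing
    \<open>v\<close>, so a point below another one of its fibre survives. At most one point per
    fibre is lost.\<close>
  have smaller: "d \<in> inner_points V R F"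
    if d: "d \<in> inner_points V R E" and d': "d' \<in> inner_points V R E"
      and eq: "d(v := 0) = d'(v := 0)" and lt: "d v < d' v" for d d'
  proof -
    have same: "d w = d' w" if "w \<noteq> v" for w using eq that by (metis fun_upd_other)
    have "sum d W < touching F W" if W: "W \<subseteq> V - R" "W \<noteq> {}" for W
    proof (cases "v \<in> W")
      case True
      have "sum d W < sum d' W"
      proof (rule sum_strict_mono_ex1)
        show "\<forall>w\<in>W. d w \<le> d' w" using lt same by (metis le_less)
      qed (use lt True finW[OF W(1)] in blast)+
      moreover have "sum d' W < touching E W" using inner_pointsD(3)[OF d' W] .
      ultimately show ?thesis using tch[OF W(1)] True by simp
    next
      case False
      then show ?thesis using inner_pointsD(3)[OF d W] tch[OF W(1)] by simp
    qed
    then show ?thesis using inner_pointsD(1,2)[OF d] ins by (intro inner_pointsI) simp_all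
  qed

  have surj: "\<exists>d\<in>inner_points V R E - inner_points V R F. d(v := 0) = d'"
    if d': "d' \<in> inner_points V (insert v R) F" for d'
  proof -
    let ?U = "V - R - {v}"
    \<comment> \<open>\<open>u B\<close> is the largest value at \<open>v\<close> allowed by the
      upper bound for \<open>insert v B\<close>; the minimum \<open>x\<close> of these is the top of
      the fibre.\<close>
    define u where "u B = touching E (insert v B) - 1 - sum d' B" for B
    have "finite (Pow ?U)" using finV by simp
    then have fin_u: "finite (u ` Pow ?U)" "u ` Pow ?U \<noteq> {}" by auto
    define x where "x = Min (u ` Pow ?U)"
    have x_le: "x \<le> u B" if "B \<subseteq> ?U" for B
      unfolding x_def using fin_u(1) that by (intro Min_le) auto
    have "x \<in> u ` Pow ?U" unfolding x_def using fin_u by (rule Min_in)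
    then obtain B where B: "B \<subseteq> ?U" "x = u B" by auto
    define d where "d = d'(v := x)"
    have d'v: "d' v = 0" by (rule inner_pointsD(1)[OF d']) simp
    have d'low: "inside E W + of_bool (W \<noteq> {}) \<le> sum d' W" if "W \<subseteq> ?U" for W
    proof (cases "W = {}")
      case True
      then show ?thesis using inside_empty[of V E] G by (simp add: E_def)
    next
      case False
      have "inside F W < sum d' W" using inner_pointsD(2)[OF d', unfolded eqU, OF that False] .
      moreover have "W \<subseteq> V - R" using that by blast
      ultimately show ?thesis using False ins[of W] by simp
    qed
    have d'up: "sum d' W + of_bool (W \<noteq> {}) \<le> touching E W" if "W \<subseteq> ?U" for W
    proof (cases "W = {}")
      case True
      then show ?thesis by (simp add: touching_empty)
    next
      case False
      have "sum d' W < touching F W" using inner_pointsD(3)[OF d', unfolded eqU, OF that False] .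
      moreover have "W \<subseteq> V - R" using that by blast
      ultimately show ?thesis using False tch[of W] by simp
    qed
    have sumd: "sum d (insert v C) = x + sum d' C" if "C \<subseteq> ?U" for C
      using sumv[OF that, of d] upd[OF that, of d' x] by (simp add: d_def)
    have tight: "sum d (insert v B) = touching E (insert v B) - 1"
      using sumd[OF B(1)] B(2) by (simp add: u_def)
    \<comment> \<open>Two units of slack are needed. For \<open>C = B\<close> they come from
      \<open>{r, v}\<close> not being a bridge; otherwise one comes from \<open>{r, v}\<close> in
      the uncrossing and one from whichever of \<open>B - C\<close> and \<open>C - B\<close> is
      nonempty.\<close>
    have low: "inside E (insert v C) < sum d (insert v C)" if C: "C \<subseteq> ?U" for C
    proof (cases "B = C")
      case True
      have "inside E (insert v C) + 2 \<le> touching E (insert v C)"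
      proof (rule inside_touching_nonbridge)
        show "graph_on V E" using G by (simp add: E_def)
        show "{r, v} \<in> E" by (simp add: E_def)
        show "r \<notin> insert v C" using C r v by auto
        show "\<forall>e\<in>T. e \<inter> insert v C = {}" using T C r by auto
        show "joined (E - {{r, v}} \<union> T) r v" using nb G(2) by (simp add: E_def)
      qed simp
      then show ?thesis using tight True by simp
    next
      case False
      have "inside E (insert v C) + touching E (B - C) + 1 \<le> touching E (insert v B) + inside E (C - B)"
      proof -
        have "v \<notin> B" "v \<notin> C" using B(1) C by auto
        then have "insert v B - insert v C = B - C" "insert v C - insert v B = C - B" by auto
        moreover have "inside E (insert v C) + touching E (insert v B - insert v C) + 1 \<le>
            touching E (insert v B) + inside E (insert v C - insert v B)"
          using B C r v by (intro inside_touching_cross[of _ r v] finE) (auto simp: E_def)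
        ultimately show ?thesis by simp
      qed
      moreover have "sum d' (B - C) + of_bool (B - C \<noteq> {}) \<le> touching E (B - C)"
        using B by (intro d'up) auto
      moreover have "inside E (C - B) + of_bool (C - B \<noteq> {}) \<le> sum d' (C - B)"
        using C by (intro d'low) auto
      moreover have "of_bool (B - C \<noteq> {}) + of_bool (C - B \<noteq> {}) \<ge> (1 :: int)"
        using False by auto
      moreover have "sum d' B = sum d' (B - C) + sum d' (B \<inter> C)"
        using finW[of B] B by (subst sum.Int_Diff[of B _ C]) auto
      moreover have "sum d' C = sum d' (C - B) + sum d' (B \<inter> C)"
        using finW[of C] C by (subst sum.Int_Diff[of C _ B]) (auto simp: Int_commute)
      ultimately show ?thesis using sumd[OF B(1)] sumd[OF C] tight by linarith
    qed
    have "inside E W < sum d W \<and> sum d W < touching E W" if W: "W \<subseteq> V - R" "W \<noteq> {}" for W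
    proof (cases "v \<in> W")
      case True
      define C where "C = W - {v}"
      have C: "W = insert v C" "C \<subseteq> ?U" using True W by (auto simp: C_def)
      show ?thesis using low[OF C(2)] sumd[OF C(2)] x_le[OF C(2)] unfolding C(1) u_def by linarith
    next
      case False
      then have "W \<subseteq> ?U" using W by auto
      then show ?thesis using d'low[of W] d'up[of W] upd[of W d' x] W(2) by (simp add: d_def)
    qed
    moreover have "d w = 0" if "w \<notin> V - R" for w
      using inner_pointsD(1)[OF d', of w] that v r by (auto simp: d_def)
    ultimately have "d \<in> inner_points V R E" by (intro inner_pointsI) simp_all
    moreover have "d \<notin> inner_points V R F"
    proof
      assume d: "d \<in> inner_points V R F"
      have Bv: "insert v B \<subseteq> V - R" using B v r by auto
      then have "sum d (insert v B) < touching F (insert v B)" using inner_pointsD(3)[OF d] by simp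
      then show False using tight tch[OF Bv] by simp
    qed
    moreover have "d(v := 0) = d'" using d'v by (simp add: d_def fun_upd_idem)
    ultimately show ?thesis by blast
  qed

  have "bij_betw (\<lambda>d. d(v := 0)) (inner_points V R E - inner_points V R F) (inner_points V (insert v R) F)"
    unfolding bij_betw_def
  proof
    show "inj_on (\<lambda>d. d(v := 0)) (inner_points V R E - inner_points V R F)"
    proof (rule inj_onI)
      fix d d' assume d: "d \<in> inner_points V R E - inner_points V R F"
        "d' \<in> inner_points V R E - inner_points V R F" and eq: "d(v := 0) = d'(v := 0)"
      then have "\<not> d v < d' v" "\<not> d' v < d v" using smaller[of d d'] smaller[of d' d] by auto
      then have "d v = d' v" by simp
      then show "d = d'" using eq by (metis fun_upd_triv fun_upd_upd)
    qed
    show "(\<lambda>d. d(v := 0)) ` (inner_points V R E - inner_points V R F) = inner_points V (insert v R) F"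
      using to surj by blast
  qed
  then have "card (inner_points V R E - inner_points V R F) = card (inner_points V (insert v R) F)"
    by (rule bij_betw_same_card)
  moreover have sub: "inner_points V R F \<subseteq> inner_points V R E"
    unfolding E_def using finF G(2) r(1) by (rule inner_points_mono)
  moreover have "card (inner_points V R E) = card (inner_points V R F) + card (inner_points V R E - inner_points V R F)"
  proof -
    have "finite (inner_points V R E)" using G(1) unfolding E_def by (rule finite_inner_points)
    then show ?thesis using sub by (metis card_Diff_subset card_mono finite_subset le_add_diff_inverse)
  qed
  ultimately show ?thesis by (simp add: E_def)
qed

section \<open>Strongly connected orientations\<close>

definition forest :: "'a set \<Rightarrow> 'a set set \<Rightarrow> bool" where
  "forest V F \<longleftrightarrow> card F + ncomp V F = card V"

lemma forest_empty: "forest V {}"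
  by (simp add: forest_def ncomp_empty)

lemma forest_insert:
  assumes "graph_on V (insert {a, b} F)" "{a, b} \<notin> F"
  shows "forest V (insert {a, b} F) \<longleftrightarrow> forest V F \<and> \<not> joined F a b"
proof -
  have g: "graph_on V F" "a \<in> V" "b \<in> V" using assms(1) by (simp_all add: graph_on_insert)
  have "ncomp V (insert {a, b} F) + of_bool (\<not> joined F a b) = ncomp V F"
    using graph_on_finite(1)[OF g(1)] g(2,3) by (rule ncomp_insert)
  then show ?thesis
    using card_le_ncomp[OF g(1)] graph_on_finite(2)[OF g(1)] assms(2)
    by (cases "joined F a b") (auto simp: forest_def)
qed

text \<open>
  \<open>T\<close> is a spanning tree of the contracted vertices \<open>R\<close>; a set of edges is a forest in the
  contracted graph iff its union with \<open>T\<close> is a forest.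
\<close>

theorem card_inner_points:
  assumes "graph_on V (E \<union> T)" "E \<inter> T = {}" "forest V T" "R \<subseteq> V" "R \<noteq> {}"
    and "\<forall>a\<in>R. \<forall>b\<in>R. joined T a b" "\<forall>e\<in>T. e \<subseteq> R"
    and "\<forall>r\<in>R. \<forall>w\<in>V. joined (E \<union> T) r w"
  shows "real (card (inner_points V R E)) =
    (-1) ^ card (V - R) * (\<Sum>F\<in>Pow E. if forest V (F \<union> T) then (-1) ^ card F else 0)"
  using assms
proof (induction "card E" arbitrary: E T R rule: less_induct)
  case less
  note G = less.prems(1) and disj = less.prems(2) and tree = less.prems(3) and RV = less.prems(4)
    and R = less.prems(5) and TR = less.prems(6) and T = less.prems(7) and conn = less.prems(8)
  have finV: "finite V" and finET: "finite (E \<union> T)" using G by (auto dest: graph_on_finite)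
  have finE: "finite E" using finET by simp
  have GE: "graph_on V E" using G by (rule graph_on_subset) simp
  show ?case
  proof (cases "R = V")
    case True
    \<comment> \<open>Every edge now joins two roots and closes a cycle with \<open>T\<close>; the
      empty subgraph matches the zero vector.\<close>
    have "\<not> forest V (F \<union> T)" if F: "F \<in> Pow E" "F \<noteq> {}" for F
    proof -
      obtain e where e: "e \<in> F" using F(2) by blast
      then have "e \<in> E" using F(1) by blast
      then obtain a b where ab: "e = {a, b}" "a \<in> V" "b \<in> V" using graph_on_edgeE[OF GE] by metis
      define H where "H = (F \<union> T) - {e}"
      have H: "F \<union> T = insert {a, b} H" "{a, b} \<notin> H" using e ab(1) by (auto simp: H_def)
      have "T \<subseteq> H" using \<open>e \<in> E\<close> disj by (auto simp: H_def)
      then have "joined H a b" using TR ab True joined_mono by metis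
      moreover have "graph_on V (F \<union> T)" using G by (rule graph_on_subset) (use F(1) in blast)
      ultimately show ?thesis using forest_insert[of V a b H] H by simp
    qed
    then have "(\<Sum>F\<in>Pow E. if forest V (F \<union> T) then (-1) ^ card F else 0) =
        (\<Sum>F\<in>Pow E. if F = {} then 1 else (0 :: real))"
      using tree by (intro sum.cong) auto
    also have "\<dots> = 1" using finE by simp
    finally have "(\<Sum>F\<in>Pow E. if forest V (F \<union> T) then (-1) ^ card F else (0 :: real)) = 1" .
    moreover have "inner_points V R E = {\<lambda>_. 0}"
      using True by (auto simp: inner_points_def)
    ultimately show ?thesis using True by simp
  next
    case False
    obtain r0 w where r0: "r0 \<in> R" "w \<in> V" "w \<notin> R" using False RV R by blast
    then have "joined (E \<union> T) w r0" using conn joined_sym by metis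
    then obtain v r where "{v, r} \<in> E \<union> T" "v \<notin> R" "r \<in> R" using joined_crossing[of _ w r0 R] r0 by blast
    then have e: "{r, v} \<in> E" "r \<in> R" "v \<notin> R" using T by (auto simp: insert_commute)
    define E' where "E' = E - {{r, v}}"
    have E: "E = insert {r, v} E'" "{r, v} \<notin> E'" using e(1) by (auto simp: E'_def)
    have v: "v \<in> V" using GE e(1) by (auto simp: graph_on_def)
    have lt: "card E' < card E" using E finE by simp
    have finE': "finite E'" using finE by (simp add: E'_def)
    have G': "graph_on V (E' \<union> T)" using G by (rule graph_on_subset) (auto simp: E'_def)
    have rvT: "{r, v} \<notin> T" using T e(3) by auto
    have card_ins: "card (insert {r, v} F) = Suc (card F)" if "F \<in> Pow E'" for F
      using card_insert_Pow[OF finE] that by (simp add: E'_def)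
    have ET: "E \<union> T = insert {r, v} (E' \<union> T)" using E(1) by simp
    have GF: "graph_on V (insert {r, v} (F \<union> T))" if "F \<in> Pow E'" for F
      using G by (rule graph_on_subset) (use that E(1) in auto)
    note split = sum_Pow_insert[OF finE e(1), folded E'_def]
    show ?thesis
    proof (cases "joined (E' \<union> T) r v")
      case nb: True
      have same: "joined (E \<union> T) = joined (E' \<union> T)" unfolding ET by (rule joined_insert_cancel[OF nb])
      have "\<not> joined T r v"
      proof
        assume "joined T r v"
        moreover have "graph_on R T" using T finV RV G by (auto simp: graph_on_def intro: finite_subset)
        ultimately have "r = v" using e(3) joined_outside by metis
        then show False using e by simp
      qed
      then have tree': "forest V (insert {r, v} T)"
        using forest_insert[of V r v T] rvT tree GF[of "{}"] by simp
      have sgn: "card (V - R) = Suc (card (V - insert v R))"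
        using finV v e(3) by (metis Diff_insert card_Suc_Diff1 DiffI finite_Diff)
      \<comment> \<open>Deletion keeps \<open>T\<close>; contraction adds \<open>{r, v}\<close> to
        it.\<close>
      have IH1: "real (card (inner_points V R E')) =
          (-1) ^ card (V - R) * (\<Sum>F\<in>Pow E'. if forest V (F \<union> T) then (-1) ^ card F else 0)"
      proof (rule less.hyps[OF lt G' _ tree RV R TR T])
        show "E' \<inter> T = {}" using disj by (auto simp: E'_def)
        show "\<forall>r\<in>R. \<forall>w\<in>V. joined (E' \<union> T) r w" using conn same by simp
      qed
      have IH2: "real (card (inner_points V (insert v R) E')) =
          (-1) ^ card (V - insert v R) * (\<Sum>F\<in>Pow E'. if forest V (F \<union> insert {r, v} T) then (-1) ^ card F else 0)"
      proof (rule less.hyps[OF lt _ _ tree'])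
        show "graph_on V (E' \<union> insert {r, v} T)" using G ET by simp
        show "E' \<inter> insert {r, v} T = {}" using disj by (auto simp: E'_def)
        show "insert v R \<subseteq> V" using v RV by simp
        have "joined (insert {r, v} T) a b" if "a \<in> R" "b \<in> R" for a b
          using TR that joined_mono[of T a b "insert {r, v} T"] by blast
        moreover have "joined (insert {r, v} T) r v" by (rule joined_edge) simp
        ultimately show "\<forall>a\<in>insert v R. \<forall>b\<in>insert v R. joined (insert {r, v} T) a b"
          using e(2) joined_sym joined_trans by (metis insert_iff joined_refl)
        show "\<forall>e\<in>insert {r, v} T. e \<subseteq> insert v R" using T e by auto
        have "joined (E \<union> T) v w" if "w \<in> V" for w
          using conn e(2) v that joined_sym joined_trans by metis
        then show "\<forall>s\<in>insert v R. \<forall>w\<in>V. joined (E' \<union> insert {r, v} T) s w"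
          using conn ET by simp
      qed simp
      have "card (inner_points V R E) = card (inner_points V R E') + card (inner_points V (insert v R) E')"
        unfolding E(1) using GE E e nb T by (intro card_inner_points_step[where T = T]) auto
      moreover have "(\<Sum>F\<in>Pow E'. if forest V (F \<union> insert {r, v} T) then (-1) ^ card F else (0 :: real)) =
          - (\<Sum>F\<in>Pow E'. if forest V (insert {r, v} F \<union> T) then (-1) ^ card (insert {r, v} F) else 0)"
        unfolding sum_negf[symmetric] by (intro sum.cong refl) (simp add: card_ins)
      ultimately show ?thesis
        unfolding split sgn using IH1 IH2 sgn by (simp add: algebra_simps)
    next
      case bridge: False
      \<comment> \<open>A bridge can be added to or removed from a forest freely, so the signs
        cancel in pairs.\<close>
      have "(\<Sum>F\<in>Pow E'. if forest V (insert {r, v} F \<union> T) then (-1) ^ card (insert {r, v} F) else 0) =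
          (\<Sum>F\<in>Pow E'. - (if forest V (F \<union> T) then (-1) ^ card F else (0 :: real)))"
      proof (intro sum.cong refl)
        fix F assume F: "F \<in> Pow E'"
        then have "{r, v} \<notin> F \<union> T" using E(2) rvT by blast
        moreover have "\<not> joined (F \<union> T) r v" using bridge F joined_mono[of "F \<union> T" r v "E' \<union> T"] by blast
        ultimately have "forest V (insert {r, v} F \<union> T) \<longleftrightarrow> forest V (F \<union> T)"
          using forest_insert[OF GF[OF F]] by simp
        then show "(if forest V (insert {r, v} F \<union> T) then (-1) ^ card (insert {r, v} F) else 0) =
            - (if forest V (F \<union> T) then (-1) ^ card F else (0 :: real))"
          using card_ins[OF F] by simp
      qed
      then have zero: "(\<Sum>F\<in>Pow E. if forest V (F \<union> T) then (-1) ^ card F else (0 :: real)) = 0"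
        unfolding split by (simp add: sum_negf)
      \<comment> \<open>\<open>W\<close> is the side of the bridge away from the roots. Only the
        bridge touches it without lying inside, which leaves no integer strictly between the two
        bounds.\<close>
      define W where "W = {w \<in> V. joined (E' \<union> T) v w}"
      have WR: "W \<subseteq> V - R"
      proof -
        have "w \<notin> R" if "joined (E' \<union> T) v w" for w
        proof
          assume "w \<in> R"
          then have "joined T r w" using TR e(2) by blast
          then have "joined (E' \<union> T) r w" by (rule joined_mono) simp
          then show False using that bridge joined_sym joined_trans by metis
        qed
        then show ?thesis by (auto simp: W_def)
      qed
      have "v \<in> W" using v by (simp add: W_def)
      have "{f \<in> E'. f \<inter> W \<noteq> {}} \<subseteq> {f \<in> E'. f \<subseteq> W}"
      proof
        fix f assume "f \<in> {f \<in> E'. f \<inter> W \<noteq> {}}"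
        then obtain p where p: "f \<in> E'" "p \<in> f" "p \<in> W" by blast
        obtain a b where ab: "f = {a, b}" "a \<in> V" "b \<in> V"
          using graph_on_edgeE[OF graph_on_subset[OF G', of E'] p(1)] by blast
        have "joined (E' \<union> T) a b" using p(1) ab(1) by (intro joined_edge) simp
        then have "joined (E' \<union> T) v a" "joined (E' \<union> T) v b"
          using p(2,3) ab(1) unfolding W_def by (auto dest: joined_sym joined_trans)
        then show "f \<in> {f \<in> E'. f \<subseteq> W}" using p(1) ab by (simp add: W_def)
      qed
      then have "touching E' W \<le> inside E' W"
        using finE' unfolding touching_def inside_def by (simp add: card_mono)
      moreover have "touching E W = touching E' W + 1" "inside E W = inside E' W"
        using touching_insert[OF finE' E(2)] inside_insert[OF finE' E(2)] \<open>v \<in> W\<close> WR e(2) E(1) by auto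
      ultimately have small: "touching E W \<le> inside E W + 1" by simp
      have "inner_points V R E = {}"
      proof (rule equals0I)
        fix d assume "d \<in> inner_points V R E"
        then have "inside E W < sum d W" "sum d W < touching E W"
          using inner_pointsD(2,3)[OF _ WR] \<open>v \<in> W\<close> by auto
        then show False using small by linarith
      qed
      then show ?thesis using zero by simp
    qed
  qed
qed

section \<open>Orientations and their indegree sequences\<close>

lemma card_edges_orients:
  assumes "orients E D"
  shows "card {e \<in> E. P e} = card {(u, v) \<in> D. P {u, v}}"
proof -
  let ?f = "\<lambda>(u, v). {u, v}"
  have inj: "inj_on ?f D" and img: "?f ` D = E"
    using assms unfolding orients_def bij_betw_def by auto
  have "{e \<in> E. P e} = ?f ` {p \<in> D. P (?f p)}" using img by blast
  moreover have "inj_on ?f {p \<in> D. P (?f p)}" using inj by (rule inj_on_subset) blast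
  moreover have "{p \<in> D. P (?f p)} = {(u, v) \<in> D. P {u, v}}" by (auto split: prod.splits)
  ultimately show ?thesis by (simp add: card_image)
qed

lemma sum_indegrees:
  assumes "finite D" "finite W"
  shows "(\<Sum>v\<in>W. indegrees D v) = card {(u, v) \<in> D. v \<in> W}"
proof -
  have fin: "finite {u. (u, v) \<in> D}" for v
  proof -
    have "{u. (u, v) \<in> D} \<subseteq> fst ` D" by force
    then show ?thesis using assms(1) by (meson finite_imageI finite_subset)
  qed
  have "(\<Sum>v\<in>W. indegrees D v) = card (SIGMA v:W. {u. (u, v) \<in> D})"
    using fin assms(2) by (simp add: indegrees_def)
  also have "\<dots> = card (prod.swap ` (SIGMA v:W. {u. (u, v) \<in> D}))"
    by (rule card_image[symmetric]) (simp add: inj_on_def)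
  also have "prod.swap ` (SIGMA v:W. {u. (u, v) \<in> D}) = {(u, v) \<in> D. v \<in> W}"
    by (auto simp: image_iff)
  finally show ?thesis .
qed

text \<open>The three quantities count arcs inside \<open>W\<close>, arcs with head in
  \<open>W\<close> and arcs touching \<open>W\<close>, an increasing chain of sets. An entering arc
  makes the first inclusion strict, a leaving arc the second.\<close>

lemma indegree_bounds:
  assumes G: "graph_on V E" and D: "orients E D" and W: "W \<subseteq> V"
  shows "inside E W \<le> (\<Sum>v\<in>W. int (indegrees D v))"
    and "(\<Sum>v\<in>W. int (indegrees D v)) \<le> touching E W"
    and "(u, v) \<in> D \<Longrightarrow> u \<notin> W \<Longrightarrow> v \<in> W \<Longrightarrow> inside E W < (\<Sum>v\<in>W. int (indegrees D v))"
    and "(u, v) \<in> D \<Longrightarrow> u \<in> W \<Longrightarrow> v \<notin> W \<Longrightarrow> (\<Sum>v\<in>W. int (indegrees D v)) < touching E W"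
    and "(\<And>u v. (u, v) \<in> D \<Longrightarrow> v \<in> W \<Longrightarrow> u \<in> W) \<Longrightarrow> (\<Sum>v\<in>W. int (indegrees D v)) \<le> inside E W"
proof -
  let ?I = "{(u, v) \<in> D. {u, v} \<subseteq> W}" and ?H = "{(u, v) \<in> D. v \<in> W}" and ?T = "{(u, v) \<in> D. {u, v} \<inter> W \<noteq> {}}"
  have "finite E" using G by (rule graph_on_finite)
  then have finD: "finite D" using D bij_betw_finite unfolding orients_def by blast
  have finW: "finite W" using W graph_on_finite(1)[OF G] by (rule finite_subset)
  have fin: "finite ?I" "finite ?H" "finite ?T" using finD by (auto intro: finite_subset[of _ D])
  have eq: "inside E W = int (card ?I)" "touching E W = int (card ?T)"
    "(\<Sum>v\<in>W. int (indegrees D v)) = int (card ?H)"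
    using card_edges_orients[OF D] sum_indegrees[OF finD finW] by (simp_all add: inside_def touching_def flip: of_nat_sum)
  show "inside E W \<le> (\<Sum>v\<in>W. int (indegrees D v))"
    unfolding eq of_nat_le_iff using fin by (intro card_mono) auto
  show "(\<Sum>v\<in>W. int (indegrees D v)) \<le> touching E W"
    unfolding eq of_nat_le_iff using fin by (intro card_mono) auto
  show "inside E W < (\<Sum>v\<in>W. int (indegrees D v))" if "(u, v) \<in> D" "u \<notin> W" "v \<in> W"
    unfolding eq of_nat_less_iff using fin that by (intro psubset_card_mono) auto
  show "(\<Sum>v\<in>W. int (indegrees D v)) < touching E W" if "(u, v) \<in> D" "u \<in> W" "v \<notin> W"
    unfolding eq of_nat_less_iff using fin that by (intro psubset_card_mono) auto
  show "(\<Sum>v\<in>W. int (indegrees D v)) \<le> inside E W" if "\<And>u v. (u, v) \<in> D \<Longrightarrow> v \<in> W \<Longrightarrow> u \<in> W"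
    unfolding eq of_nat_le_iff using fin that by (intro card_mono) auto
qed

lemma orients_verts: "graph_on V E \<Longrightarrow> orients E D \<Longrightarrow> (u, v) \<in> D \<Longrightarrow> u \<in> V \<and> v \<in> V"
  using orients_edge[of E D u v] by (auto simp: graph_on_def)

lemma indegrees_outside:
  assumes "graph_on V E" "orients E D" "v \<notin> V"
  shows "indegrees D v = 0"
proof -
  have "{u. (u, v) \<in> D} = {}" using orients_verts[OF assms(1,2)] assms(3) by blast
  then show ?thesis by (simp add: indegrees_def)
qed

lemma rtrancl_crossing:
  assumes "(r, v) \<in> D\<^sup>*" "r \<notin> A" "v \<in> A"
  shows "\<exists>p q. (p, q) \<in> D \<and> p \<notin> A \<and> q \<in> A"
proof (rule ccontr)
  assume no: "\<not> ?thesis"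
  from assms(1) have "v \<notin> A" by (induction rule: rtrancl_induct) (use no assms(2) in auto)
  then show False using assms(3) by simp
qed

text \<open>A nonempty set avoiding \<open>r\<close> is entered and left by arcs, which gives the
  two strict bounds. Conversely, no arc enters the set of vertices unreachable from
  \<open>u\<close>, so its lower bound is not strict and it must be empty.\<close>

lemma strongly_connected_iff:
  fixes G :: "'a ugraph"
  defines "V \<equiv> verts G" and "E \<equiv> edges G"
  assumes G: "graph_on V E" and D: "orients E D" and r: "r \<in> V"
  defines "d \<equiv> \<lambda>v. if v = r then 0 else int (indegrees D v)"
  shows "strongly_connected G D \<longleftrightarrow> d \<in> inner_points V {r} E"
proof
  assume sc: "strongly_connected G D"
  have reach: "(u, v) \<in> D\<^sup>*" if "u \<in> V" "v \<in> V" for u v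
    using sc that by (simp add: strongly_connected_def V_def)
  show "d \<in> inner_points V {r} E"
  proof (rule inner_pointsI)
    fix v assume "v \<notin> V - {r}"
    then show "d v = 0" using indegrees_outside[OF G D, of v] by (auto simp: d_def)
  next
    fix W assume W: "W \<subseteq> V - {r}" "W \<noteq> {}"
    then obtain w where w: "w \<in> W" "w \<in> V" by blast
    have WV: "W \<subseteq> V" "r \<notin> W" using W by auto
    have eq: "sum d W = (\<Sum>v\<in>W. int (indegrees D v))" using WV(2) by (intro sum.cong) (auto simp: d_def)
    obtain p q where "(p, q) \<in> D" "p \<notin> W" "q \<in> W"
      using rtrancl_crossing[OF reach[OF r w(2)] WV(2) w(1)] by blast
    then show "inside E W < sum d W" unfolding eq by (rule indegree_bounds(3)[OF G D WV(1)])
    obtain p q where "(p, q) \<in> D" "p \<notin> - W" "q \<in> - W"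
      using rtrancl_crossing[OF reach[OF w(2) r], of "- W"] w(1) WV(2) by blast
    then show "sum d W < touching E W" unfolding eq by (intro indegree_bounds(4)[OF G D WV(1)]) auto
  qed
next
  assume d: "d \<in> inner_points V {r} E"
  have finV: "finite V" using G by (rule graph_on_finite)
  have total: "(\<Sum>v\<in>V. int (indegrees D v)) = int (card E)"
  proof -
    have *: "inside E V = int (card E)" "touching E V = int (card E)"
      using inside_plus_touching[OF G order_refl] inside_plus_touching[OF G empty_subsetI] inside_empty[OF G]
      by (simp_all add: touching_empty)
    then show ?thesis using indegree_bounds(1,2)[OF G D order_refl] by simp
  qed
  \<comment> \<open>If \<open>U\<close> contains \<open>r\<close>, its lower bound is the upper
    bound of the complement, as the total is |E|.\<close>
  have above: "inside E U < (\<Sum>v\<in>U. int (indegrees D v))" if U: "U \<subseteq> V" "U \<noteq> {}" "U \<noteq> V" for U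
  proof (cases "r \<in> U")
    case False
    then have "sum d U = (\<Sum>v\<in>U. int (indegrees D v))" by (intro sum.cong) (auto simp: d_def)
    moreover have "inside E U < sum d U" using False U by (intro inner_pointsD(2)[OF d]) auto
    ultimately show ?thesis by simp
  next
    case True
    have W: "V - U \<subseteq> V - {r}" "V - U \<noteq> {}" using True U by auto
    have "sum d (V - U) = (\<Sum>v\<in>V - U. int (indegrees D v))" using True by (intro sum.cong) (auto simp: d_def)
    also have "\<dots> = int (card E) - (\<Sum>v\<in>U. int (indegrees D v))"
      using total sum_diff[OF finV U(1), of "\<lambda>v. int (indegrees D v)"] by simp
    finally have "int (card E) - (\<Sum>v\<in>U. int (indegrees D v)) < touching E (V - U)"
      using inner_pointsD(3)[OF d W] by simp
    moreover have "inside E U + touching E (V - U) = int (card E)"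
      using inside_plus_touching[OF G, of "V - U"] U(1) by (simp add: double_diff)
    ultimately show ?thesis by linarith
  qed
  show "strongly_connected G D"
    unfolding strongly_connected_def V_def[symmetric]
  proof (intro ballI)
    fix u v assume uv: "u \<in> V" "v \<in> V"
    define U where "U = {w \<in> V. (u, w) \<notin> D\<^sup>*}"
    have "(\<Sum>v\<in>U. int (indegrees D v)) \<le> inside E U"
    proof (rule indegree_bounds(5)[OF G D])
      fix p q assume pq: "(p, q) \<in> D" "q \<in> U"
      then have "p \<in> V" using orients_verts[OF G D] by blast
      then show "p \<in> U" using pq by (auto simp: U_def intro: rtrancl.rtrancl_into_rtrancl)
    qed (auto simp: U_def)
    moreover have "U \<subseteq> V" "U \<noteq> V" using uv(1) by (auto simp: U_def)
    ultimately have "U = {}" using above[of U] by linarith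
    then show "(u, v) \<in> D\<^sup>*" using uv(2) by (auto simp: U_def)
  qed
qed

lemma inner_points_weak:
  assumes "graph_on V E" "d \<in> inner_points V R E" "W \<subseteq> V - R"
  shows "inside E W \<le> sum d W \<and> sum d W \<le> touching E W"
  using inner_pointsD(2,3)[OF assms(2,3)] inside_empty[OF assms(1)] touching_empty[of E]
  by (cases "W = {}") simp_all

text \<open>The total |E| forces the value \<open>c\<close> at \<open>r\<close>. The lower bounds
  required by \<open>exists_orientation\<close> then hold for sets containing \<open>r\<close> by
  the upper bounds of their complements.\<close>

lemma inner_point_realizable:
  assumes G: "graph_on V E" and r: "r \<in> V" and d: "d \<in> inner_points V {r} E"
  shows "\<exists>D. orients E D \<and> (\<lambda>v. if v = r then 0 else int (indegrees D v)) = d"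
proof -
  have finV: "finite V" using G by (rule graph_on_finite)
  define c where "c = int (card E) - sum d V"
  have dr: "d r = 0" by (rule inner_pointsD(1)[OF d]) simp
  have upd: "sum (d(r := c)) U = sum d U + (if r \<in> U then c else 0)" if "U \<subseteq> V" for U
    using sum_fun_upd[OF finite_subset[OF that finV], of d r c] dr by simp
  have "\<exists>D. orients E D \<and> (\<forall>v\<in>V. int (indegrees D v) = (d(r := c)) v)"
  proof (rule exists_orientation[OF G])
    show "sum (d(r := c)) V = int (card E)" using upd[of V] r by (simp add: c_def)
    show "\<forall>U\<subseteq>V. inside E U \<le> sum (d(r := c)) U"
    proof (intro allI impI)
      fix U assume U: "U \<subseteq> V"
      show "inside E U \<le> sum (d(r := c)) U"
      proof (cases "r \<in> U")
        case False
        then have "U \<subseteq> V - {r}" using U by auto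
        then have "inside E U \<le> sum d U"
          using inner_points_weak[OF G d] by blast
        then show ?thesis using upd[OF U] False by simp
      next
        case True
        then have "V - U \<subseteq> V - {r}" by auto
        then have "sum d (V - U) \<le> touching E (V - U)"
          using inner_points_weak[OF G d] by blast
        moreover have "sum d (V - U) = sum d V - sum d U" using finV U by (rule sum_diff)
        moreover have "inside E U + touching E (V - U) = int (card E)"
          using inside_plus_touching[OF G, of "V - U"] U by (simp add: double_diff)
        ultimately show ?thesis using upd[OF U] True by (simp add: c_def)
      qed
    qed
  qed
  then obtain D where D: "orients E D" "\<forall>v\<in>V. int (indegrees D v) = (d(r := c)) v" by blast
  have "(if v = r then 0 else int (indegrees D v)) = d v" for v
  proof (cases "v \<in> V")
    case True
    then show ?thesis using D(2) dr by simp
  next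
    case False
    then have "indegrees D v = 0" by (rule indegrees_outside[OF G D(1)])
    moreover have "d v = 0" using False by (intro inner_pointsD(1)[OF d]) simp
    ultimately show ?thesis by simp
  qed
  then show ?thesis using D(1) by blast
qed

theorem card_indegrees_strongly_connected:
  fixes G :: "'a ugraph"
  defines "V \<equiv> verts G" and "E \<equiv> edges G"
  assumes G: "graph_on V E" and conn: "ncomp V E = 1" and r: "r \<in> V"
  shows "real (card (indegrees ` {D. orientation G D \<and> strongly_connected G D})) =
    (-1) ^ (card V - 1) * (\<Sum>F\<in>Pow E. if card F + ncomp V F = card V then (-1) ^ card F else 0)"
proof -
  have finV: "finite V" using G by (rule graph_on_finite)
  let ?S = "{D. orientation G D \<and> strongly_connected G D}"
  \<comment> \<open>\<open>f\<close> drops the indegree of the root; it is injective on indegree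
    sequences because their total is |E|.\<close>
  define f where "f i = (\<lambda>v. if v = r then 0 else int (i v))" for i :: "'a \<Rightarrow> nat"
  have orient: "orientation G D \<longleftrightarrow> orients E D" for D by (simp add: orientation_def orients_def E_def)
  have sc: "strongly_connected G D \<longleftrightarrow> f (indegrees D) \<in> inner_points V {r} E" if "orients E D" for D
    using strongly_connected_iff[of G D r] G r that unfolding f_def V_def E_def by simp
  have "f ` indegrees ` ?S = inner_points V {r} E"
  proof (intro equalityI subsetI)
    fix d assume "d \<in> f ` indegrees ` ?S"
    then show "d \<in> inner_points V {r} E" using orient sc by auto
  next
    fix d assume d: "d \<in> inner_points V {r} E"
    then obtain D where "orients E D" "f (indegrees D) = d"
      using inner_point_realizable[OF G r] unfolding f_def by blast
    then show "d \<in> f ` indegrees ` ?S" using orient sc d by (auto intro!: imageI)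
  qed
  moreover have "inj_on f (indegrees ` ?S)"
  proof (rule inj_onI)
    have total: "int (i r) = int (card E) - sum (f i) V" if "i \<in> indegrees ` ?S" for i
    proof -
      obtain D where D: "i = indegrees D" "orients E D" using \<open>i \<in> indegrees ` ?S\<close> orient by blast
      have "inside E V = int (card E)" "touching E V = int (card E)"
        using inside_plus_touching[OF G order_refl] inside_plus_touching[OF G empty_subsetI] inside_empty[OF G]
        by (simp_all add: touching_empty)
      then have "(\<Sum>v\<in>V. int (i v)) = int (card E)"
        using indegree_bounds(1,2)[OF G D(2) order_refl] D(1) by simp
      moreover have "f i = (\<lambda>v. int (i v))(r := 0)" by (auto simp: f_def)
      ultimately show ?thesis using sum_fun_upd[OF finV, of "\<lambda>v. int (i v)" r 0] r by simp
    qed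
    fix i j assume ij: "i \<in> indegrees ` ?S" "j \<in> indegrees ` ?S" "f i = f j"
    then have "int (i r) = int (j r)" using total by metis
    moreover have "int (i v) = int (j v)" if "v \<noteq> r" for v
      using fun_cong[OF ij(3), of v] that by (simp add: f_def)
    ultimately show "i = j" by (metis ext of_nat_eq_iff)
  qed
  ultimately have "card (indegrees ` ?S) = card (inner_points V {r} E)" by (metis card_image)
  moreover have "joined E r w" if "w \<in> V" for w using ncomp_eq_1_iff[OF finV r] conn that by blast
  then have "real (card (inner_points V {r} E)) =
      (-1) ^ card (V - {r}) * (\<Sum>F\<in>Pow E. if forest V (F \<union> {}) then (-1) ^ card F else 0)"
    using G r by (intro card_inner_points) (auto simp: forest_empty)
  moreover have "card (V - {r}) = card V - 1" using finV r by simp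
  ultimately show ?thesis by (simp add: forest_def)
qed

theorem theorem3:
  fixes n :: nat
  shows "((\<forall>r\<in>verts (Gn n).
             real (card {D. orientation (Gn n) D \<and> acyclic D \<and> root_connected (Gn n) r D})
               = tutte (Gn n) 1 0) \<and>
          tutte (Gn n) 1 0 = (\<Prod>i=0..n. (real i + 1) ^ (2 * 4 ^ (n - i)))) \<and>
         (real (card (indegrees ` {D. orientation (Gn n) D \<and> strongly_connected (Gn n) D}))
             = tutte (Gn n) 0 1 \<and>
          tutte (Gn n) 0 1 = real n / 2 * (\<Prod>i=0..n. (real i + 1) ^ (2 * 4 ^ (n - i))))"
proof (intro conjI ballI)
  fix r assume "r \<in> verts (Gn n)"
  then show "real (card {D. orientation (Gn n) D \<and> acyclic D \<and> root_connected (Gn n) r D}) = tutte (Gn n) 1 0"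
    unfolding tutte_1_0[OF graph_on_Gn ncomp_Gn] by (rule card_acyclic_root_connected[OF graph_on_Gn ncomp_Gn])
next
  show "real (card (indegrees ` {D. orientation (Gn n) D \<and> strongly_connected (Gn n) D})) = tutte (Gn n) 0 1"
    unfolding tutte_0_1[OF graph_on_Gn ncomp_Gn]
    by (rule card_indegrees_strongly_connected[OF graph_on_Gn ncomp_Gn special_in_Gn(1)])
qed (fact tutte_Gn)+

end
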